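(* Let $a\in C^1(\mathbb T)$ be real valued with $0<\inf_{\mathbb T} a<\sup_{\mathbb T} a<\infty$. Put $\kappa=\big(\mathbb E[a^{-1}]\big)^{-1}$, $q(x)=\kappa^{-1}-a(x)^{-1}$ and $$c_a=\frac{\kappa}{8}\Big(\mathbb E\big[q^2(x)\big]+2\sum_{s=1}^\infty\mathbb E\big[q(x)q(2^sx)\big]\Big).$$ Then $c_a\ge0$, and the Lyapunov exponent $L(E)$ of the divergence-gradient cocycle driven by the doubling map satisfies, as $E\to0^+$, $$L(E)=c_aE+\mathcal O(|\log E|^2E^{3/2}),$$ where the implied constant may depend on $a$ but not on $E$.
   Context: $\mathbb T=\mathbb R/\mathbb Z$ and $\mathbb E[f]=\int_{\mathbb T}f(x)\,dx$. For $x\in\mathbb T$, $n\in\mathbb Z_{\ge0}$ put $a_n=a_n(x)=a(2^n x \bmod 1)$. For $E\in\mathbb R$ the transfer matrices are $T_0^E=\mathrm{Id}$ and, for $n\ge1$, $$T_n^E(x)=A_{n-1}^E\cdots A_0^E,\qquad A_j^E=\frac1{a_j}\begin{pmatrix}a_{j+1}+a_j-E&-a_j^2\\1&0\end{pmatrix}\in SL(2,\mathbb R).$$ The Lyapunov exponent is $$L(E)=\inf_{n>0}\frac1n\mathbb E\big[\log\|T_n^E(x)\|\big]=\lim_{n\to\infty}\frac1n\log\|T_n^E(x)\|\quad\text{for a.e. }x,$$ with $\|\cdot\|$ the operator norm. *)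

theory Defs
  imports "HOL-Analysis.Analysis" "HOL-Library.Landau_Symbols"
begin

text \<open>Functions on the circle \<open>\<real>/\<int>\<close> are represented by their 1-periodic lifts to the real line.\<close>

definition C1_circle :: "(real \<Rightarrow> real) \<Rightarrow> bool" where
  "C1_circle a \<longleftrightarrow> (\<forall>x. a (x + 1) = a x) \<and> a C1_differentiable_on UNIV"

definition circle_mean :: "(real \<Rightarrow> real) \<Rightarrow> real" where
  "circle_mean f = (LINT x:{0..1}|lborel. f x)"

definition sample :: "(real \<Rightarrow> real) \<Rightarrow> nat \<Rightarrow> real \<Rightarrow> real" where
  "sample a n x = a (frac (2 ^ n * x))"

definition cocycle_step :: "(real \<Rightarrow> real) \<Rightarrow> real \<Rightarrow> nat \<Rightarrow> real \<Rightarrow> real^2^2" where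
  "cocycle_step a E j x =
     (1 / sample a j x) *\<^sub>R
       vector [vector [sample a (Suc j) x + sample a j x - E, - (sample a j x)\<^sup>2],
               vector [1, 0]]"

primrec transfer_matrix :: "(real \<Rightarrow> real) \<Rightarrow> real \<Rightarrow> nat \<Rightarrow> real \<Rightarrow> real^2^2" where
  "transfer_matrix a E 0 x = mat 1"
| "transfer_matrix a E (Suc n) x = cocycle_step a E n x ** transfer_matrix a E n x"

text \<open>The infimum is taken over nonnegative numbers: each transfer matrix has determinant 1,
  hence operator norm at least 1.\<close>

definition lyapunov :: "(real \<Rightarrow> real) \<Rightarrow> real \<Rightarrow> real" where
  "lyapunov a E =
     (INF n\<in>{0<..}. (1 / real n) * circle_mean (\<lambda>x. ln (onorm ((*v) (transfer_matrix a E n x)))))"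

definition kappa :: "(real \<Rightarrow> real) \<Rightarrow> real" where
  "kappa a = inverse (circle_mean (\<lambda>x. inverse (a x)))"

definition q_fun :: "(real \<Rightarrow> real) \<Rightarrow> real \<Rightarrow> real" where
  "q_fun a x = inverse (kappa a) - inverse (a x)"

definition q_corr :: "(real \<Rightarrow> real) \<Rightarrow> nat \<Rightarrow> real" where
  "q_corr a s = circle_mean (\<lambda>x. q_fun a x * q_fun a (2 ^ s * x))"

text \<open>The correlation series over \<open>s \<ge> 1\<close> is indexed from 0 via \<open>Suc\<close>.\<close>

definition c_coeff :: "(real \<Rightarrow> real) \<Rightarrow> real" where
  "c_coeff a =
     kappa a / 8 * (circle_mean (\<lambda>x. (q_fun a x)\<^sup>2) + 2 * (\<Sum>s. q_corr a (Suc s)))"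

end

theory Submission
  imports Defs "HOL-Real_Asymp.Real_Asymp"
begin

text \<open>With \<open>\<epsilon> = sqrt (E / \<kappa>)\<close> and \<open>r = \<kappa> q\<close>, a change of coordinates, bounded for fixed \<open>E\<close>, turns
  each step of the cocycle into a rotation of the unit disk by about \<open>2 \<epsilon>\<close>, perturbed by
  \<open>\<epsilon> r (2^n x)\<close>. Identifying \<open>SL(2,\<real>)\<close> with \<open>SU(1,1)\<close>,
  \<open>T\<^sub>n\<close> becomes \<open>\<zeta> \<mapsto> \<alpha>\<^sub>n \<zeta> + \<beta>\<^sub>n cnj \<zeta>\<close>; the norm of \<open>T\<^sub>n\<close> is comparable to \<open>\<bar>\<alpha>\<^sub>n\<bar>\<close>, and
  \<open>z\<^sub>n = cnj \<beta>\<^sub>n / \<alpha>\<^sub>n\<close> evolves in the unit disk by Moebius maps. Because \<open>z\<^sub>n\<close> starts at the centre,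
  \<open>ln \<bar>\<alpha>\<^sub>n\<bar>\<close> averages over all initial vectors, and its increments are real parts of holomorphic
  functions of \<open>z\<^sub>n\<close>. Expanding them to second order in \<open>\<epsilon>\<close>, the mean of \<open>r (2^n x) z\<^sub>n\<close> is computed by
  freezing \<open>z\<close> about \<open>\<bar>log \<epsilon>\<bar>\<close> steps earlier: \<open>z\<^sub>k\<close> varies at scale \<open>2\<^sup>-\<^sup>k\<close>, so it decorrelates
  exponentially from later samples, and this produces the correlation series. The means of \<open>z\<^sub>n\<close> and
  \<open>z\<^sub>n\<^sup>2\<close> telescope away because of the rotation. The freezing error \<open>\<epsilon>\<^sup>3 \<bar>log \<epsilon>\<bar>\<^sup>2\<close> is the error
  of the theorem, and subadditivity identifies the limit with the infimum.\<close>

section \<open>Decorrelation under the doubling map\<close>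

text \<open>The right-hand integrand is the transfer operator of the doubling map applied to
  \<open>h\<close>, a sum over the inverse branches \<open>y/2\<close> and \<open>(y+1)/2\<close>.
  Each branch maps onto one half of the interval, so substitution preserves the integral.\<close>

lemma integral_half_split:
  fixes h :: "real \<Rightarrow> 'a::banach"
  assumes "continuous_on {0..1} h"
  shows "integral {0..1} h = integral {0..1} (\<lambda>y. (1/2) *\<^sub>R (h (y/2) + h ((y+1)/2)))"
proof -
  have i1: "h integrable_on {0..1/2}" and i2: "h integrable_on {1/2..1}"
    by (auto intro!: integrable_continuous_real continuous_on_subset[OF assms])
  have a1: "((\<lambda>y. h (y/2)) has_integral 2 *\<^sub>R integral {0..1/2} h) {0..1}"
    using has_integral_affinity[OF integrable_integral[OF i1, unfolded cbox_interval[symmetric]], of "1/2" 0]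
    by simp
  have im: "(\<lambda>x. 2 * x - 1) ` {1/2..1} = {0..1::real}"
    by (subst image_affinity_atLeastAtMost_diff) auto
  have a2: "((\<lambda>y. h ((y+1)/2)) has_integral 2 *\<^sub>R integral {1/2..1} h) {0..1}"
    using has_integral_affinity[OF integrable_integral[OF i2, unfolded cbox_interval[symmetric]], of "1/2" "1/2"] im
    by (simp add: add_divide_distrib)
  have "((\<lambda>y. (1/2) *\<^sub>R (h (y/2) + h ((y+1)/2))) has_integral
      (1/2) *\<^sub>R (2 *\<^sub>R integral {0..1/2} h + 2 *\<^sub>R integral {1/2..1} h)) {0..1}"
    by (intro has_integral_cmul has_integral_add a1 a2)
  moreover have "integral {0..1/2} h + integral {1/2..1} h = integral {0..1} h"
    by (rule Henstock_Kurzweil_Integration.integral_combine)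
       (auto intro!: integrable_continuous_real assms)
  ultimately show ?thesis
    by (simp add: integral_unique scaleR_add_right)
qed

section \<open>Periodic functions on the line\<close>

lemma periodic_add_nat:
  fixes g :: "real \<Rightarrow> 'a"
  assumes "\<And>x. g (x + 1) = g x"
  shows "g (x + real n) = g x"
proof (induction n)
  case (Suc n)
  have "g (x + real (Suc n)) = g ((x + real n) + 1)" by (simp add: algebra_simps)
  then show ?case using assms Suc by simp
qed simp

lemma periodic_frac:
  fixes g :: "real \<Rightarrow> 'a"
  assumes "\<And>x. g (x + 1) = g x"
  shows "g (frac x) = g x"
proof (cases "x \<ge> 0")
  case True
  then show ?thesis using periodic_add_nat[of g "frac x" "nat \<lfloor>x\<rfloor>", OF assms] by (simp add: frac_def)
next
  case False
  then show ?thesis using periodic_add_nat[of g x "nat (- \<lfloor>x\<rfloor>)", OF assms] by (simp add: frac_def)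
qed

lemma periodic_bounded:
  fixes g :: "real \<Rightarrow> real"
  assumes "continuous_on UNIV g" "\<And>x. g (x + 1) = g x"
  shows "\<exists>B. \<forall>x. \<bar>g x\<bar> \<le> B"
proof -
  have "bounded (g ` {0..1})"
    by (intro compact_imp_bounded compact_continuous_image continuous_on_subset[OF assms(1)]) auto
  then obtain B where B: "\<bar>g x\<bar> \<le> B" if "x \<in> {0..1}" for x
    unfolding bounded_iff by (metis imageI real_norm_def)
  have "\<bar>g x\<bar> \<le> B" for x
    using B[of "frac x"] frac_lt_1[of x] by (simp add: periodic_frac[of g, OF assms(2)])
  then show ?thesis by blast
qed

text \<open>The transfer operator of the doubling map halves the Lipschitz constant of \<open>f\<close>.\<close>

lemma doubling_decorrelation:
  fixes f :: "real \<Rightarrow> 'a::banach" and g :: "real \<Rightarrow> real"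
  assumes g: "continuous_on UNIV g" "\<And>x. g (x + 1) = g x" "\<And>x. \<bar>g x\<bar> \<le> B"
    and f: "K-lipschitz_on {0..1} f"
  shows "norm (integral {0..1} (\<lambda>x. g (2^n * x) *\<^sub>R f x)
     - integral {0..1} g *\<^sub>R integral {0..1} f) \<le> K * B / 2^n"
  using f
proof (induction n arbitrary: f K)
  case 0
  let ?c = "integral {0..1} f"
  have K: "0 \<le> K" using 0 by (rule lipschitz_on_nonneg)
  have B: "0 \<le> B" using g(3)[of 0] by linarith
  have cf: "continuous_on {0..1} f" using 0 by (rule lipschitz_on_continuous_on)
  have cg: "continuous_on {0..1} g" using g(1) continuous_on_subset by blast
  \<comment> \<open>On an interval of length 1 every value of \<open>f\<close> lies within
    \<open>K\<close> of the mean of \<open>f\<close>.\<close>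
  have fc: "norm (f x - ?c) \<le> K" if x: "x \<in> {0..1}" for x
  proof -
    have "f x - ?c = integral {0..1} (\<lambda>y. f x - f y)"
      by (subst Henstock_Kurzweil_Integration.integral_diff) (auto intro!: integrable_continuous_real cf)
    also have "norm \<dots> \<le> K * (1 - 0)"
    proof (rule integral_bound)
      fix t :: real assume "t \<in> {0..1}"
      then have "norm (f x - f t) \<le> K * dist x t" using lipschitz_onD[OF 0 x] by (simp add: dist_norm)
      also have "\<dots> \<le> K * 1" using K x \<open>t \<in> {0..1}\<close>
        by (intro mult_left_mono) (auto simp: dist_real_def)
      finally show "norm (f x - f t) \<le> K" by simp
    qed (auto intro!: continuous_intros cf)
    finally show ?thesis by simp
  qed
  have "integral {0..1} (\<lambda>x. g x *\<^sub>R f x) - integral {0..1} g *\<^sub>R ?c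
      = integral {0..1} (\<lambda>x. g x *\<^sub>R (f x - ?c))"
  proof -
    have "integral {0..1} (\<lambda>x. g x *\<^sub>R ?c) = integral {0..1} g *\<^sub>R ?c"
      using integrable_integral[OF integrable_continuous_real[OF cg]]
      by (intro integral_unique has_integral_scaleR_left)
    then show ?thesis
      unfolding scaleR_diff_right
      by (subst Henstock_Kurzweil_Integration.integral_diff)
         (auto intro!: integrable_continuous_real continuous_intros cf cg)
  qed
  also have "norm \<dots> \<le> (K * B) * (1 - 0)"
  proof (rule integral_bound)
    fix t :: real assume t: "t \<in> {0..1}"
    show "norm (g t *\<^sub>R (f t - ?c)) \<le> K * B"
      using mult_mono[OF g(3)[of t] fc[OF t] B] by (simp add: mult.commute)
  qed (auto intro!: continuous_intros cf cg)
  finally show ?case by simp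
next
  case (Suc n)
  define Lf where "Lf = (\<lambda>y. (1/2::real) *\<^sub>R (f (y/2) + f ((y+1)/2)))"
  have K: "0 \<le> K" using Suc.prems by (rule lipschitz_on_nonneg)
  have cf: "continuous_on {0..1} f" using Suc.prems by (rule lipschitz_on_continuous_on)
  have L: "(K/2)-lipschitz_on {0..1} Lf"
  proof (rule lipschitz_onI)
    fix x y :: real assume xy: "x \<in> {0..1}" "y \<in> {0..1}"
    have 1: "dist (f (x/2)) (f (y/2)) \<le> K * dist (x/2) (y/2)"
      by (rule lipschitz_onD[OF Suc.prems]) (use xy in auto)
    have 2: "dist (f ((x+1)/2)) (f ((y+1)/2)) \<le> K * dist ((x+1)/2) ((y+1)/2)"
      by (rule lipschitz_onD[OF Suc.prems]) (use xy in auto)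
    have d: "dist (x/2) (y/2) = dist x y / 2" "dist ((x+1)/2) ((y+1)/2) = dist x y / 2"
      by (simp_all add: dist_real_def abs_divide flip: diff_divide_distrib)
    have "Lf x - Lf y = (1/2) *\<^sub>R ((f (x/2) - f (y/2)) + (f ((x+1)/2) - f ((y+1)/2)))"
      by (simp add: Lf_def algebra_simps)
    then have "norm (Lf x - Lf y) \<le> (1/2) * (norm (f (x/2) - f (y/2)) + norm (f ((x+1)/2) - f ((y+1)/2)))"
      by (simp add: norm_triangle_ineq del: scaleR_add_right)
    then show "dist (Lf x) (Lf y) \<le> K/2 * dist x y"
      using 1 2 unfolding d by (simp add: dist_norm)
  qed (use K in simp)
  have "integral {0..1} (\<lambda>x. g (2^Suc n * x) *\<^sub>R f x) = integral {0..1} (\<lambda>y. g (2^n * y) *\<^sub>R Lf y)"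
  proof -
    \<comment> \<open>Under \<open>2 ^ Suc n\<close> the two inverse branches differ by the integer
      \<open>2^n\<close>, so \<open>g\<close> agrees on both and one doubling is transferred from
      \<open>g\<close> to \<open>f\<close>.\<close>
    have "2 ^ Suc n * ((y+1)/2) = 2^n * y + real (2^n)" for y :: real
      by (simp add: field_simps)
    then have "g (2 ^ Suc n * ((y+1)/2)) = g (2^n * y)" for y
      by (simp only: periodic_add_nat[of g, OF g(2)])
    then show ?thesis
      by (subst integral_half_split)
         (auto simp: Lf_def scaleR_add_right mult.commute intro!: continuous_intros cf continuous_on_compose2[OF g(1)])
  qed
  moreover have "integral {0..1} f = integral {0..1} Lf"
    unfolding Lf_def by (rule integral_half_split[OF cf])
  ultimately show ?case using Suc.IH[OF L] by simp
qed

text \<open>A constant \<open>f\<close> has Lipschitz constant 0, so the decorrelation bound becomes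
  an equality.\<close>

corollary integral_doubling_invariant:
  fixes g :: "real \<Rightarrow> real"
  assumes g: "continuous_on UNIV g" "\<And>x. g (x + 1) = g x"
  shows "integral {0..1} (\<lambda>x. g (2^n * x)) = integral {0..1} g"
proof -
  obtain B where "\<And>x. \<bar>g x\<bar> \<le> B" using periodic_bounded[OF g] by blast
  from doubling_decorrelation[of g B 0 "\<lambda>x. 1::real" n, OF g this]
  show ?thesis by (simp add: lipschitz_on_def)
qed

section \<open>One step in the unit disk\<close>

text \<open>In the coordinate \<open>\<zeta> = \<phi> + \<i> \<psi>\<close> the shear \<open>\<psi> := \<psi> + \<epsilon> (1 - \<rho>) \<phi>\<close> followed by
  \<open>\<phi> := \<phi> - \<epsilon> \<psi>\<close> is the real-linear map \<open>\<zeta> \<mapsto> step_diag * \<zeta> + step_off * cnj \<zeta>\<close>. If a product of such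
  maps is \<open>\<zeta> \<mapsto> \<alpha> * \<zeta> + \<beta> * cnj \<zeta>\<close> and \<open>z = cnj \<beta> / \<alpha>\<close>, then one more step multiplies \<open>\<alpha>\<close> by
  \<open>step_gain\<close> and sends \<open>z\<close> to \<open>step_moebius\<close>.\<close>

definition step_diag :: "real \<Rightarrow> real \<Rightarrow> complex" where
  "step_diag \<epsilon> \<rho> = 1 + \<i> * of_real (\<epsilon> * (1 - \<rho>/2)) - of_real (\<epsilon>\<^sup>2 * (1 - \<rho>) / 2)"

definition step_off :: "real \<Rightarrow> real \<Rightarrow> complex" where
  "step_off \<epsilon> \<rho> = - \<i> * of_real (\<epsilon> * \<rho> / 2) - of_real (\<epsilon>\<^sup>2 * (1 - \<rho>) / 2)"

definition step_gain :: "real \<Rightarrow> real \<Rightarrow> complex \<Rightarrow> complex" where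
  "step_gain \<epsilon> \<rho> z = step_diag \<epsilon> \<rho> + step_off \<epsilon> \<rho> * z"

definition step_moebius :: "real \<Rightarrow> real \<Rightarrow> complex \<Rightarrow> complex" where
  "step_moebius \<epsilon> \<rho> z = (cnj (step_diag \<epsilon> \<rho>) * z + cnj (step_off \<epsilon> \<rho>)) / step_gain \<epsilon> \<rho> z"

text \<open>The coefficient of \<open>\<epsilon>\<close> in \<open>step_moebius\<close>: the
  generator \<open>- 2 * \<i> * z\<close> of a rotation of the disk, plus a forcing proportional to
  the sample \<open>\<rho>\<close>.\<close>

definition step_drift :: "real \<Rightarrow> complex \<Rightarrow> complex" where
  "step_drift \<rho> z = \<i> * (of_real (\<rho>/2) * (1 + z)\<^sup>2 - 2 * z)"

text \<open>The step is a product of two shears, and a real-linear map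
  \<open>\<zeta> \<mapsto> A * \<zeta> + B * cnj \<zeta>\<close> has determinant
  \<open>A * cnj A - B * cnj B\<close>.\<close>

lemma step_det: "step_diag \<epsilon> \<rho> * cnj (step_diag \<epsilon> \<rho>) - step_off \<epsilon> \<rho> * cnj (step_off \<epsilon> \<rho>) = 1"
  by (simp add: complex_eq_iff step_diag_def step_off_def field_simps power2_eq_square)

text \<open>An element of SU(1,1) preserves the indefinite form
  \<open>\<bar>u\<bar>^2 - \<bar>v\<bar>^2\<close>; here it is applied to the vector
  \<open>(1, z)\<close>.\<close>

lemma step_norm_identity:
  "(cmod (step_gain \<epsilon> \<rho> z))\<^sup>2 - (cmod (cnj (step_diag \<epsilon> \<rho>) * z + cnj (step_off \<epsilon> \<rho>)))\<^sup>2 = 1 - (cmod z)\<^sup>2"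
proof -
  let ?a = "step_diag \<epsilon> \<rho>" and ?b = "step_off \<epsilon> \<rho>"
  have "of_real ((cmod (step_gain \<epsilon> \<rho> z))\<^sup>2 - (cmod (cnj ?a * z + cnj ?b))\<^sup>2)
     = (?a * cnj ?a - ?b * cnj ?b) * (1 - z * cnj z)"
    unfolding of_real_diff complex_norm_square step_gain_def by (simp add: algebra_simps)
  also have "\<dots> = of_real (1 - (cmod z)\<^sup>2)"
    unfolding step_det by (simp add: complex_norm_square flip: of_real_power)
  finally show ?thesis by (simp only: of_real_eq_iff)
qed

lemma step_moebius_in_disk:
  assumes "cmod z \<le> 1" "step_gain \<epsilon> \<rho> z \<noteq> 0"
  shows "cmod (step_moebius \<epsilon> \<rho> z) \<le> 1"
proof -
  have "(cmod z)\<^sup>2 \<le> 1" using assms(1) by (simp add: power_le_one)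
  then have "(cmod (cnj (step_diag \<epsilon> \<rho>) * z + cnj (step_off \<epsilon> \<rho>)))\<^sup>2 \<le> (cmod (step_gain \<epsilon> \<rho> z))\<^sup>2"
    using step_norm_identity[of \<epsilon> \<rho> z] by linarith
  then have "cmod (cnj (step_diag \<epsilon> \<rho>) * z + cnj (step_off \<epsilon> \<rho>)) \<le> cmod (step_gain \<epsilon> \<rho> z)"
    by (rule power2_le_imp_le) simp
  then show ?thesis using assms(2) by (simp add: step_moebius_def norm_divide divide_le_eq)
qed

section \<open>Second-order expansion of the logarithm\<close>

lemma abs_ln_one_plus_second_order:
  fixes y :: real
  assumes "\<bar>y\<bar> \<le> 1/2"
  shows "\<bar>ln (1 + y) - y + y\<^sup>2/2\<bar> \<le> 2 * \<bar>y\<bar>^3"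
proof -
  let ?f = "\<lambda>t::real. ln (1 + t) - t + t\<^sup>2/2"
  \<comment> \<open>The remainder has derivative \<open>t\<^sup>2/(1+t)\<close>, so the mean value
    inequality gives a cubic bound.\<close>
  have "norm (?f y - ?f 0) \<le> (2 * y\<^sup>2) * norm (y - 0)"
  proof (rule field_differentiable_bound[where S="{-\<bar>y\<bar>..\<bar>y\<bar>}" and f'="\<lambda>t. t\<^sup>2/(1+t)"])
    fix t assume t: "t \<in> {-\<bar>y\<bar>..\<bar>y\<bar>}"
    have t2: "t \<ge> -1/2" "t \<le> 1/2" using t assms by auto
    have "(?f has_field_derivative (1/(1+t) - 1 + t)) (at t within {-\<bar>y\<bar>..\<bar>y\<bar>})"
      using t2 by (auto intro!: derivative_eq_intros)
    moreover have "1/(1+t) - 1 + t = t\<^sup>2/(1+t)" using t2 by (simp add: field_simps power2_eq_square)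
    ultimately show "(?f has_field_derivative t\<^sup>2/(1+t)) (at t within {-\<bar>y\<bar>..\<bar>y\<bar>})" by simp
    have "t\<^sup>2/(1+t) \<le> t\<^sup>2/(1/2)" using t2 by (intro divide_left_mono) auto
    also have "\<dots> \<le> 2 * y\<^sup>2" using abs_le_square_iff[of t y] t by simp arith
    finally show "norm (t\<^sup>2/(1+t)) \<le> 2 * y\<^sup>2" using t2 by simp
  qed (use assms in auto)
  then show ?thesis by (simp add: power3_eq_cube power2_eq_square abs_mult_self_eq mult.assoc)
qed

text \<open>\<open>Re (h - h\<^sup>2/2)\<close> is the real part of the second-order Taylor
  polynomial of the complex logarithm. The real case applies to the squared modulus
  \<open>1 + y\<close>. The threshold 3/20 is what \<open>3 * R * \<epsilon>\<close> is allowed to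
  be below.\<close>

lemma ln_cmod_one_plus_second_order:
  assumes "cmod h \<le> 3/20"
  shows "\<bar>ln (cmod (1 + h)) - Re (h - h\<^sup>2/2)\<bar> \<le> 12 * cmod h ^ 3"
proof -
  define y where "y = 2 * Re h + (cmod h)\<^sup>2"
  let ?k = "cmod h"
  have k: "0 \<le> ?k" "?k \<le> 3/20" "\<bar>Re h\<bar> \<le> ?k" using assms abs_Re_le_cmod by auto
  have kk: "?k\<^sup>2 \<le> 3/20 * ?k" using mult_right_mono[OF k(2,1)] by (simp add: power2_eq_square)
  have y: "\<bar>y\<bar> \<le> 43/20 * ?k" unfolding y_def
    by (intro abs_leI) (use kk k zero_le_power2[of ?k] in linarith)+
  have y2: "\<bar>y\<bar> \<le> 1/2" using y k by linarith
  have sq: "(cmod (1 + h))\<^sup>2 = 1 + y"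
    unfolding y_def cmod_power2 by (simp add: power2_eq_square algebra_simps)
  have pos: "1 + y > 0" using y2 by linarith
  have c: "cmod (1+h) > 0" using sq pos by auto
  have "ln (1 + y) = 2 * ln (cmod (1 + h))" unfolding sq[symmetric] using c by (simp add: ln_realpow)
  then have 1: "\<bar>2 * ln (cmod (1 + h)) - y + y\<^sup>2/2\<bar> \<le> 2 * \<bar>y\<bar>^3"
    using abs_ln_one_plus_second_order[OF y2] by simp
  have 2: "\<bar>y\<bar>^3 \<le> (43/20)^3 * ?k^3" using power_mono[OF y, of 3] by (simp only: power_mult_distrib abs_ge_zero)
  have id: "y - y\<^sup>2/2 = 2 * Re (h - h\<^sup>2/2) - (2 * Re h * ?k\<^sup>2 + ?k\<^sup>2 * ?k\<^sup>2/2)"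
  proof -
    have "Re (h\<^sup>2) = 2 * (Re h)\<^sup>2 - ?k\<^sup>2" unfolding cmod_power2 by (simp add: power2_eq_square)
    then have r: "2 * Re (h - h\<^sup>2/2) = 2 * Re h - 2 * (Re h)\<^sup>2 + ?k\<^sup>2"
      by (simp only: minus_complex.sel Re_divide_numeral) (simp add: diff_divide_distrib)
    show ?thesis unfolding r unfolding y_def by (simp add: power2_eq_square algebra_simps)
  qed
  have 3: "\<bar>2 * Re h * ?k\<^sup>2\<bar> \<le> 2 * ?k^3"
    using mult_right_mono[OF k(3), of "2 * ?k\<^sup>2"] by (simp add: abs_mult power2_eq_square power3_eq_cube mult.assoc)
  have 4: "?k\<^sup>2 * ?k\<^sup>2/2 \<le> ?k^3"
  proof -
    have "?k\<^sup>2 * ?k\<^sup>2 = ?k * ?k^3" by (simp add: power2_eq_square power3_eq_cube)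
    then show ?thesis using mult_right_mono[OF k(2), of "?k^3"] k(1) zero_le_power[OF k(1), of 3] by linarith
  qed
  have k3: "0 \<le> ?k^3" "0 \<le> ?k\<^sup>2 * ?k\<^sup>2 / 2" by simp_all
  have "(43/20)^3 * ?k^3 \<le> 10 * ?k^3"
    using k3(1) by (intro mult_right_mono) (simp_all add: power3_eq_cube)
  then have 5: "\<bar>y\<bar>^3 \<le> 10 * ?k^3" using 2 by linarith
  \<comment> \<open>Twice the error is at most \<open>2 * 10 + 2 + 1 = 23\<close> times the cube,
    and half of 23 is below 12.\<close>
  have "\<bar>ln (cmod (1 + h)) - X\<bar> \<le> 12 * ?k^3"
    if "\<bar>2 * L - y + Y\<bar> \<le> 2 * \<bar>y\<bar>^3" "y - Y = 2 * X - (u + v)" "\<bar>u\<bar> \<le> 2 * ?k^3" "v \<le> ?k^3" "0 \<le> v" "L = ln (cmod (1 + h))"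
    for X Y L u v :: real
    using that 5 by (simp add: abs_le_iff)
  from this[OF 1 id 3 4 k3(2) refl] show ?thesis .
qed

section \<open>Uniform estimates for one step at small \<open>\<epsilon>\<close>\<close>

context
  fixes \<epsilon> R :: real
  assumes eps: "0 < \<epsilon>" "\<epsilon> * R \<le> 1/20" and R: "1 \<le> R"
begin

lemma eps_small: "\<epsilon> \<le> 1/20" "\<epsilon> \<le> \<epsilon> * R"
proof -
  show "\<epsilon> \<le> \<epsilon> * R" using mult_left_mono[OF R, of \<epsilon>] eps by simp
  then show "\<epsilon> \<le> 1/20" using eps by linarith
qed

lemma step_gain_expand:
  "step_gain \<epsilon> \<rho> z = 1 + (of_real \<epsilon> * (\<i> * (1 - of_real \<rho>/2 - of_real \<rho>/2*z))
      + of_real \<epsilon>^2 * (- (1 - of_real \<rho>) / 2 * (1 + z)))"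
  by (simp add: step_gain_def step_diag_def step_off_def algebra_simps diff_divide_distrib add_divide_distrib)

lemma norm_eps_power_mult: "cmod (of_real \<epsilon>^n * w) = \<epsilon>^n * cmod w"
  using eps by (simp add: norm_mult norm_power)

lemma step_coeff_bounds:
  assumes "\<bar>\<rho>\<bar> \<le> R" "cmod z \<le> 1"
  shows "cmod (\<i> * (1 - of_real \<rho>/2 - of_real \<rho>/2*z)) \<le> 2 * R"
    and "cmod (- (1 - of_real \<rho>) / 2 * (1 + z)) \<le> 2 * R"
    and "cmod (step_drift \<rho> z) \<le> 4 * R"
proof -
  have z1: "cmod (1 + z) \<le> 2" using norm_triangle_ineq[of 1 z] assms by simp
  have z2: "(cmod (1 + z))\<^sup>2 \<le> 4" using power_mono[OF z1, of 2] by simp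
  have rz: "\<bar>\<rho>\<bar> * cmod z \<le> R * 1" using assms R by (intro mult_mono) auto
  have "cmod (1 - of_real \<rho>/2 - of_real \<rho>/2*z) \<le> cmod 1 + cmod (of_real \<rho>/2) + cmod (of_real \<rho>/2*z)"
    by (meson norm_triangle_ineq4 order_trans add_right_mono)
  also have "\<dots> = 1 + \<bar>\<rho>\<bar>/2 + \<bar>\<rho>\<bar> * cmod z / 2" by (simp add: norm_mult norm_divide)
  also have "\<dots> \<le> 2 * R" using assms R rz by linarith
  finally show "cmod (\<i> * (1 - of_real \<rho>/2 - of_real \<rho>/2*z)) \<le> 2 * R" by (simp add: norm_mult)
  have "cmod (1 - of_real \<rho>) \<le> 2 * R" using norm_triangle_ineq4[of 1 "of_real \<rho> :: complex"] assms R by simp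
  then have "cmod (1 - of_real \<rho>) * cmod (1 + z) \<le> (2 * R) * 2" using z1 R by (intro mult_mono) auto
  moreover have "cmod (- (1 - of_real \<rho>) / 2 * (1 + z)) = cmod (1 - of_real \<rho>) * cmod (1 + z) / 2"
    by (simp only: norm_mult norm_divide norm_minus_cancel) simp
  ultimately show "cmod (- (1 - of_real \<rho>) / 2 * (1 + z)) \<le> 2 * R" by linarith
  have "\<bar>\<rho>\<bar> * (cmod (1 + z))\<^sup>2 \<le> R * 4" using assms z2 R by (intro mult_mono) auto
  then show "cmod (step_drift \<rho> z) \<le> 4 * R"
    using norm_triangle_ineq4[of "of_real (\<rho>/2) * (1 + z)\<^sup>2" "2 * z"] assms R
    by (simp add: step_drift_def norm_mult norm_power norm_divide)
qed

lemma step_gain_near_one: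
  assumes "\<bar>\<rho>\<bar> \<le> R" "cmod z \<le> 1"
  shows "cmod (step_gain \<epsilon> \<rho> z - 1) \<le> 3 * R * \<epsilon>" "17/20 \<le> cmod (step_gain \<epsilon> \<rho> z)"
proof -
  have "cmod (step_gain \<epsilon> \<rho> z - 1) \<le> \<epsilon> * (2 * R) + \<epsilon>^2 * (2 * R)"
    unfolding step_gain_expand add_diff_cancel_left'
    using step_coeff_bounds(1,2)[OF assms] eps
    by (intro order_trans[OF norm_triangle_ineq] add_mono)
       (auto simp: norm_mult norm_power intro!: mult_left_mono)
  also have "\<epsilon>^2 * (2 * R) \<le> \<epsilon> * R"
    using mult_right_mono[OF eps_small(1), of "\<epsilon> * R"] eps R by (simp add: power2_eq_square mult.assoc)
  finally show 1: "cmod (step_gain \<epsilon> \<rho> z - 1) \<le> 3 * R * \<epsilon>" by (simp add: algebra_simps)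
  have "1 \<le> cmod (step_gain \<epsilon> \<rho> z) + cmod (step_gain \<epsilon> \<rho> z - 1)"
    using norm_triangle_ineq4[of "step_gain \<epsilon> \<rho> z" "step_gain \<epsilon> \<rho> z - 1"] by simp
  then show "17/20 \<le> cmod (step_gain \<epsilon> \<rho> z)" using 1 eps(2) by (simp add: algebra_simps)
qed

lemma step_moebius_expansion:
  assumes "\<bar>\<rho>\<bar> \<le> R" "cmod z \<le> 1"
  shows "cmod (step_moebius \<epsilon> \<rho> z - z - of_real \<epsilon> * step_drift \<rho> z) \<le> 20 * R^2 * \<epsilon>^2"
proof -
  let ?D = "step_gain \<epsilon> \<rho> z" and ?V = "step_drift \<rho> z"
  let ?d = "- (1 - of_real \<rho>) / 2 * (1 + z)"
  have D: "?D \<noteq> 0" using step_gain_near_one(2)[OF assms] by auto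
  \<comment> \<open>The numerator minus \<open>z\<close> times the denominator has
    \<open>\<epsilon>\<close> times the drift as its whole first-order part; only a multiple of
    \<open>\<epsilon>^2\<close> remains.\<close>
  have num: "cnj (step_diag \<epsilon> \<rho>) * z + cnj (step_off \<epsilon> \<rho>) - z * ?D - of_real \<epsilon> * ?V
      = of_real \<epsilon>^2 * (?d * (1 - z))"
    unfolding step_gain_def step_diag_def step_off_def step_drift_def
    by (simp add: algebra_simps power2_eq_square diff_divide_distrib add_divide_distrib)
  have "step_moebius \<epsilon> \<rho> z - z - of_real \<epsilon> * ?V = (of_real \<epsilon>^2 * (?d * (1 - z)) - of_real \<epsilon> * ?V * (?D - 1)) / ?D"
    unfolding num[symmetric] step_moebius_def using D by (simp add: field_simps)
  then have e: "cmod (step_moebius \<epsilon> \<rho> z - z - of_real \<epsilon> * ?V)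
      = cmod (of_real \<epsilon>^2 * (?d * (1 - z)) - of_real \<epsilon> * ?V * (?D - 1)) / cmod ?D"
    by (simp only: norm_divide)
  have "cmod (of_real \<epsilon>^2 * (?d * (1 - z)) - of_real \<epsilon> * ?V * (?D - 1))
     \<le> cmod (of_real \<epsilon>^2 * (?d * (1 - z))) + cmod (of_real \<epsilon> * ?V * (?D - 1))" by (rule norm_triangle_ineq4)
  also have "cmod (of_real \<epsilon>^2 * (?d * (1 - z))) \<le> \<epsilon>^2 * (2 * R * 2)"
  proof -
    have "cmod (1 - z) \<le> 2" using norm_triangle_ineq4[of 1 z] assms by simp
    then have "cmod ?d * cmod (1 - z) \<le> 2 * R * 2" using step_coeff_bounds(2)[OF assms] R by (intro mult_mono) auto
    then have "cmod (?d * (1 - z)) \<le> 2 * R * 2" by (simp only: norm_mult)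
    then show ?thesis unfolding norm_eps_power_mult by (rule mult_left_mono) (use eps in simp)
  qed
  also have "cmod (of_real \<epsilon> * ?V * (?D - 1)) \<le> \<epsilon> * (4 * R) * (3 * R * \<epsilon>)"
    unfolding norm_mult using step_coeff_bounds(3)[OF assms] step_gain_near_one(1)[OF assms] eps R
    by (intro mult_mono) (auto intro!: mult_nonneg_nonneg)
  also have "\<epsilon>^2 * (2 * R * 2) \<le> \<epsilon>^2 * (4 * R^2)"
    using R by (intro mult_left_mono) (auto simp: power2_eq_square)
  also have "\<epsilon>^2 * (4 * R^2) + \<epsilon> * (4 * R) * (3 * R * \<epsilon>) = 16 * (R^2 * \<epsilon>^2)"
    by (simp add: power2_eq_square)
  \<comment> \<open>The constant 20 leaves room for division by the gain, whose modulus is at least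
    17/20: indeed \<open>16 \<le> 20 * 17/20\<close>.\<close>
  also have "\<dots> \<le> (20 * R^2 * \<epsilon>^2) * (17/20)" by simp
  also have "\<dots> \<le> (20 * R^2 * \<epsilon>^2) * cmod ?D"
    by (intro mult_left_mono step_gain_near_one(2)[OF assms]) auto
  finally show ?thesis unfolding e using D by (simp add: divide_le_eq)
qed

lemma step_moebius_increment:
  assumes "\<bar>\<rho>\<bar> \<le> R" "cmod z \<le> 1"
  shows "cmod (step_moebius \<epsilon> \<rho> z - z) \<le> 5 * R * \<epsilon>"
proof -
  have "cmod (step_moebius \<epsilon> \<rho> z - z) \<le> cmod (step_moebius \<epsilon> \<rho> z - z - of_real \<epsilon> * step_drift \<rho> z) + cmod (of_real \<epsilon> * step_drift \<rho> z)"
    using norm_triangle_ineq[of "step_moebius \<epsilon> \<rho> z - z - of_real \<epsilon> * step_drift \<rho> z" "of_real \<epsilon> * step_drift \<rho> z"] by simp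
  also have "cmod (of_real \<epsilon> * step_drift \<rho> z) \<le> \<epsilon> * (4 * R)"
    using step_coeff_bounds(3)[OF assms] eps by (simp add: norm_mult)
  also have "cmod (step_moebius \<epsilon> \<rho> z - z - of_real \<epsilon> * step_drift \<rho> z) \<le> 20 * R^2 * \<epsilon>^2"
    by (rule step_moebius_expansion[OF assms])
  also have "20 * R^2 * \<epsilon>^2 \<le> R * \<epsilon>"
    using mult_right_mono[OF eps(2), of "20 * (R * \<epsilon>)"] R eps by (simp add: power2_eq_square algebra_simps)
  finally show ?thesis by (simp add: algebra_simps)
qed

text \<open>First \<open>z\<close> varies, then \<open>\<rho>\<close>. The factor 3/2, an upper
  bound for the inverse square of 17/20, has to stay below 2: the orbit must not oscillate faster
  than the doubling map expands.\<close>

lemma step_moebius_lipschitz: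
  assumes "\<bar>\<rho>\<bar> \<le> R" "\<bar>\<rho>'\<bar> \<le> R" "cmod z \<le> 1" "cmod z' \<le> 1"
  shows "cmod (step_moebius \<epsilon> \<rho> z - step_moebius \<epsilon> \<rho>' z') \<le> 3/2 * cmod (z - z') + 5 * \<epsilon> * \<bar>\<rho> - \<rho>'\<bar>"
proof -
  let ?D = "step_gain \<epsilon>" and ?M = "step_moebius \<epsilon>"
  have D: "17/20 \<le> cmod (?D \<rho> z)" "17/20 \<le> cmod (?D \<rho> z')" "17/20 \<le> cmod (?D \<rho>' z')"
    using step_gain_near_one(2) assms by auto
  then have D0: "?D \<rho> z \<noteq> 0" "?D \<rho> z' \<noteq> 0" "?D \<rho>' z' \<noteq> 0" by auto
  \<comment> \<open>The difference of two values of a Moebius map is the determinant, here 1, times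
    the difference of the arguments over the product of the denominators.\<close>
  have "?M \<rho> z - ?M \<rho> z' = (z - z') * (step_diag \<epsilon> \<rho> * cnj (step_diag \<epsilon> \<rho>) - step_off \<epsilon> \<rho> * cnj (step_off \<epsilon> \<rho>)) / (?D \<rho> z * ?D \<rho> z')"
  proof -
    have "?M \<rho> z - ?M \<rho> z' = ((cnj (step_diag \<epsilon> \<rho>) * z + cnj (step_off \<epsilon> \<rho>)) * ?D \<rho> z'
        - (cnj (step_diag \<epsilon> \<rho>) * z' + cnj (step_off \<epsilon> \<rho>)) * ?D \<rho> z) / (?D \<rho> z * ?D \<rho> z')"
      unfolding step_moebius_def using D0 by (simp add: diff_frac_eq)
    then show ?thesis unfolding step_gain_def by (simp add: algebra_simps)
  qed
  then have "cmod (?M \<rho> z - ?M \<rho> z') = cmod (z - z') / (cmod (?D \<rho> z) * cmod (?D \<rho> z'))"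
    unfolding step_det by (simp add: norm_divide norm_mult)
  also have "\<dots> \<le> cmod (z - z') / (17/20 * (17/20))"
    using D by (intro divide_left_mono mult_mono mult_pos_pos) auto
  finally have 1: "cmod (?M \<rho> z - ?M \<rho> z') \<le> 3/2 * cmod (z - z')"
    using norm_ge_zero[of "z - z'"] by (simp only: times_divide_times_eq divide_divide_eq_right)
  define k where "k = of_real (\<rho> - \<rho>') * (1 + z')"
  have dN: "(cnj (step_diag \<epsilon> \<rho>) * z' + cnj (step_off \<epsilon> \<rho>)) - (cnj (step_diag \<epsilon> \<rho>') * z' + cnj (step_off \<epsilon> \<rho>'))
      = k * (\<i> * of_real (\<epsilon>/2) + of_real (\<epsilon>\<^sup>2/2))"
    by (simp add: step_diag_def step_off_def k_def algebra_simps diff_divide_distrib add_divide_distrib)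
  have dD: "?D \<rho> z' - ?D \<rho>' z' = k * (- \<i> * of_real (\<epsilon>/2) + of_real (\<epsilon>\<^sup>2/2))"
    by (simp add: step_gain_def step_diag_def step_off_def k_def algebra_simps diff_divide_distrib add_divide_distrib)
  have k: "cmod k \<le> 2 * \<bar>\<rho> - \<rho>'\<bar>"
  proof -
    have "cmod (1 + z') \<le> 2" using norm_triangle_ineq[of 1 z'] assms by simp
    then have "\<bar>\<rho> - \<rho>'\<bar> * cmod (1 + z') \<le> \<bar>\<rho> - \<rho>'\<bar> * 2" by (intro mult_left_mono) auto
    moreover have "cmod k = \<bar>\<rho> - \<rho>'\<bar> * cmod (1 + z')"
      unfolding k_def norm_mult norm_of_real by simp
    ultimately show ?thesis by simp
  qed
  have e2: "\<epsilon>\<^sup>2/2 \<le> \<epsilon>/40"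
    using mult_right_mono[OF eps_small(1), of \<epsilon>] eps by (simp add: power2_eq_square)
  have "cmod (\<i> * of_real (\<epsilon>/2) + of_real (\<epsilon>\<^sup>2/2)) \<le> \<epsilon>/2 + \<epsilon>\<^sup>2/2"
    by (rule order_trans[OF norm_triangle_ineq]) (use eps in \<open>simp add: norm_mult norm_divide norm_power\<close>)
  then have n1: "cmod (k * (\<i> * of_real (\<epsilon>/2) + of_real (\<epsilon>\<^sup>2/2))) \<le> 2 * \<bar>\<rho> - \<rho>'\<bar> * (21/40 * \<epsilon>)"
    unfolding norm_mult[of k] using k e2 by (intro mult_mono) auto
  have "cmod (- \<i> * of_real (\<epsilon>/2) + of_real (\<epsilon>\<^sup>2/2)) \<le> \<epsilon>/2 + \<epsilon>\<^sup>2/2"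
    by (rule order_trans[OF norm_triangle_ineq]) (use eps in \<open>simp add: norm_mult norm_divide norm_power\<close>)
  then have n2: "cmod (k * (- \<i> * of_real (\<epsilon>/2) + of_real (\<epsilon>\<^sup>2/2))) \<le> 2 * \<bar>\<rho> - \<rho>'\<bar> * (21/40 * \<epsilon>)"
    unfolding norm_mult[of k] using k e2 by (intro mult_mono) auto
  \<comment> \<open>This is \<open>N/D - N'/D' = ((N - N') - (N'/D') * (D - D')) / D\<close>, where
    \<open>N'/D'\<close> lies in the closed unit disk.\<close>
  have "?M \<rho> z' - ?M \<rho>' z' = (k * (\<i> * of_real (\<epsilon>/2) + of_real (\<epsilon>\<^sup>2/2))
      - ?M \<rho>' z' * (k * (- \<i> * of_real (\<epsilon>/2) + of_real (\<epsilon>\<^sup>2/2)))) / ?D \<rho> z'"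
    unfolding dN[symmetric] dD[symmetric] step_moebius_def using D0 by (simp add: field_simps)
  then have "cmod (?M \<rho> z' - ?M \<rho>' z') = cmod (k * (\<i> * of_real (\<epsilon>/2) + of_real (\<epsilon>\<^sup>2/2))
      - ?M \<rho>' z' * (k * (- \<i> * of_real (\<epsilon>/2) + of_real (\<epsilon>\<^sup>2/2)))) / cmod (?D \<rho> z')"
    by (simp only: norm_divide)
  also have "\<dots> \<le> (2 * \<bar>\<rho> - \<rho>'\<bar> * (21/40 * \<epsilon>) + 1 * (2 * \<bar>\<rho> - \<rho>'\<bar> * (21/40 * \<epsilon>))) / (17/20)"
  proof (rule frac_le)
    show "cmod (k * (\<i> * of_real (\<epsilon>/2) + of_real (\<epsilon>\<^sup>2/2))
      - ?M \<rho>' z' * (k * (- \<i> * of_real (\<epsilon>/2) + of_real (\<epsilon>\<^sup>2/2)))) \<le> 2 * \<bar>\<rho> - \<rho>'\<bar> * (21/40 * \<epsilon>) + 1 * (2 * \<bar>\<rho> - \<rho>'\<bar> * (21/40 * \<epsilon>))"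
      by (rule order_trans[OF norm_triangle_ineq4 add_mono[OF n1]], subst norm_mult,
          rule mult_mono[OF step_moebius_in_disk[OF assms(4) D0(3)] n2]) auto
  qed (use D eps in auto)
  also have "\<dots> \<le> 5 * \<epsilon> * \<bar>\<rho> - \<rho>'\<bar>"
    using mult_nonneg_nonneg[OF less_imp_le[OF eps(1)] abs_ge_zero[of "\<rho> - \<rho>'"]] by (simp add: algebra_simps)
  finally have 2: "cmod (?M \<rho> z' - ?M \<rho>' z') \<le> 5 * \<epsilon> * \<bar>\<rho> - \<rho>'\<bar>" .
  have "cmod (?M \<rho> z - ?M \<rho>' z') \<le> cmod (?M \<rho> z - ?M \<rho> z') + cmod (?M \<rho> z' - ?M \<rho>' z')"
    using norm_triangle_ineq[of "?M \<rho> z - ?M \<rho> z'" "?M \<rho> z' - ?M \<rho>' z'"] by simp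
  then show ?thesis using 1 2 by linarith
qed

text \<open>The logarithm is expanded at \<open>1 + h\<close>, where \<open>h\<close> has an
  explicit first- and second-order part. The constant in the first-order part is imaginary, so at
  order \<open>\<epsilon>\<close> only \<open>\<rho> * Im z\<close> survives;
  \<open>\<rho>\<^sup>2/8\<close> later yields the lag-0 correlation. The error is
  \<open>330 = 12 * 27 + 6\<close>.\<close>

lemma ln_step_gain_expansion:
  assumes "\<bar>\<rho>\<bar> \<le> R" "cmod z \<le> 1"
  shows "\<bar>ln (cmod (step_gain \<epsilon> \<rho> z)) - (\<epsilon>/2 * \<rho> * Im z + \<epsilon>\<^sup>2 * (\<rho>\<^sup>2/8 +
     Re (of_real (\<rho>\<^sup>2/4 - 1/2) * z + of_real (\<rho>\<^sup>2/8) * z\<^sup>2)))\<bar> \<le> 330 * R^3 * \<epsilon>^3"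
proof -
  let ?d = "\<i> * (1 - of_real \<rho>/2 - of_real \<rho>/2*z)" and ?e = "- (1 - of_real \<rho>) / 2 * (1 + z)"
  define h where "h = step_gain \<epsilon> \<rho> z - 1"
  have hk: "cmod h \<le> 3 * R * \<epsilon>" unfolding h_def by (rule step_gain_near_one(1)[OF assms])
  have h_small: "cmod h \<le> 3/20" using hk eps by (simp add: algebra_simps)
  have h3: "cmod h ^ 3 \<le> 27 * R^3 * \<epsilon>^3"
    using power_mono[OF hk norm_ge_zero, of 3] by (simp add: power_mult_distrib)
  have 1: "\<bar>ln (cmod (step_gain \<epsilon> \<rho> z)) - Re (h - h\<^sup>2/2)\<bar> \<le> 12 * (27 * R^3 * \<epsilon>^3)"
    using ln_cmod_one_plus_second_order[OF h_small] h3 by (simp add: h_def)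
  have hd: "h = of_real \<epsilon> * ?d + of_real \<epsilon>^2 * ?e" by (simp only: h_def step_gain_expand add_diff_cancel_left')
  have id': "(e * d + e^2 * c) - (e * d + e^2 * c)\<^sup>2/2 = e * d + e^2 * (c - d\<^sup>2/2) - e^3 * (d * c + e * c\<^sup>2 / 2)"
    for e d c :: complex
    by (simp add: power2_eq_square power3_eq_cube algebra_simps add_divide_distrib diff_divide_distrib)
  have id: "h - h\<^sup>2/2 = of_real \<epsilon> * ?d + of_real \<epsilon>^2 * (?e - ?d\<^sup>2/2) - of_real \<epsilon>^3 * (?d * ?e + of_real \<epsilon> * ?e\<^sup>2 / 2)"
    unfolding hd by (rule id')
  have main: "?e - ?d\<^sup>2/2 = of_real (\<rho>\<^sup>2/8) + (of_real (\<rho>\<^sup>2/4 - 1/2) * z + of_real (\<rho>\<^sup>2/8) * z\<^sup>2)"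
    by (simp add: power2_eq_square field_simps)
  have Re_of_real_mult: "Re (of_real c * w) = c * Re w" for c w by simp
  have e1: "\<epsilon> \<le> 1" using eps_small(1) by linarith
  have red: "Re (of_real \<epsilon> * ?d) = \<epsilon>/2 * \<rho> * Im z" by simp
  have re2: "Re (of_real \<epsilon>^2 * (?e - ?d\<^sup>2/2)) = \<epsilon>\<^sup>2 * (\<rho>\<^sup>2/8 +
     Re (of_real (\<rho>\<^sup>2/4 - 1/2) * z + of_real (\<rho>\<^sup>2/8) * z\<^sup>2))"
    unfolding main of_real_power[symmetric] Re_complex_of_real plus_complex.sel Re_of_real_mult by simp
  have "cmod (?d * ?e + of_real \<epsilon> * ?e\<^sup>2 / 2) \<le> (2 * R) * (2 * R) + 1 * (2 * R)^2 / 2"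
  proof (rule order_trans[OF norm_triangle_ineq], rule add_mono)
    show "cmod (?d * ?e) \<le> (2 * R) * (2 * R)"
      unfolding norm_mult[of ?d] using step_coeff_bounds(1,2)[OF assms] R by (intro mult_mono) auto
    have "\<epsilon> * (cmod ?e)^2 \<le> 1 * (2 * R)^2"
      using step_coeff_bounds(2)[OF assms] eps e1 by (intro mult_mono power_mono) auto
    then show "cmod (of_real \<epsilon> * ?e\<^sup>2 / 2) \<le> 1 * (2 * R)^2 / 2"
      using eps by (simp only: norm_divide norm_mult[of "of_real \<epsilon>"] norm_power) simp
  qed
  also have "\<dots> = 6 * R^2" by (simp add: power2_eq_square)
  also have "\<dots> \<le> 6 * R^3" using R by (simp add: power2_eq_square power3_eq_cube)
  finally have "cmod (of_real \<epsilon>^3 * (?d * ?e + of_real \<epsilon> * ?e\<^sup>2 / 2)) \<le> \<epsilon>^3 * (6 * R^3)"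
    unfolding norm_eps_power_mult by (rule mult_left_mono) (use eps in simp)
  then have 2: "\<bar>Re (of_real \<epsilon>^3 * (?d * ?e + of_real \<epsilon> * ?e\<^sup>2 / 2))\<bar> \<le> \<epsilon>^3 * (6 * R^3)"
    using abs_Re_le_cmod order_trans by blast
  have 3: "Re (h - h\<^sup>2/2) = (\<epsilon>/2 * \<rho> * Im z + \<epsilon>\<^sup>2 * (\<rho>\<^sup>2/8 +
     Re (of_real (\<rho>\<^sup>2/4 - 1/2) * z + of_real (\<rho>\<^sup>2/8) * z\<^sup>2)))
     - Re (of_real \<epsilon>^3 * (?d * ?e + of_real \<epsilon> * ?e\<^sup>2 / 2))"
    unfolding id minus_complex.sel plus_complex.sel(1)[of "of_real \<epsilon> * ?d"] red re2 ..
  have "12 * (27 * R^3 * \<epsilon>^3) + \<epsilon>^3 * (6 * R^3) = 330 * R^3 * \<epsilon>^3" by simp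
  then show ?thesis using 1 2 unfolding 3 by linarith
qed

end

section \<open>The disk orbit driven by the doubling map\<close>

text \<open>The starting value 0 belongs to the identity map, for which \<open>\<alpha> = 1\<close>
  and \<open>\<beta> = 0\<close>.\<close>

primrec disk_orbit :: "(real \<Rightarrow> real) \<Rightarrow> real \<Rightarrow> nat \<Rightarrow> real \<Rightarrow> complex" where
  "disk_orbit r \<epsilon> 0 x = 0"
| "disk_orbit r \<epsilon> (Suc n) x = step_moebius \<epsilon> (r (2^n * x)) (disk_orbit r \<epsilon> n x)"

definition orbit_gain :: "(real \<Rightarrow> real) \<Rightarrow> real \<Rightarrow> nat \<Rightarrow> real \<Rightarrow> complex" where
  "orbit_gain r \<epsilon> n x = step_gain \<epsilon> (r (2^n * x)) (disk_orbit r \<epsilon> n x)"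

definition doubling_corr :: "(real \<Rightarrow> real) \<Rightarrow> nat \<Rightarrow> real" where
  "doubling_corr r s = integral {0..1} (\<lambda>x. r x * r (2^s * x))"

section \<open>Averages, telescoping sums and elementary bounds on the disk\<close>

lemma norm_mean_le:
  fixes f :: "real \<Rightarrow> 'a::banach"
  assumes "continuous_on {0..1} f" "\<And>x. norm (f x) \<le> B"
  shows "norm (integral {0..1} f) \<le> B"
  using integral_bound[of 0 1 f B] assms by simp

lemma norm_mean_diff_le:
  fixes f :: "real \<Rightarrow> 'a::banach"
  assumes "continuous_on {0..1} f" "continuous_on {0..1} g" "\<And>x. norm (f x - g x) \<le> B"
  shows "norm (integral {0..1} f - integral {0..1} g) \<le> B"
proof -
  have "integral {0..1} f - integral {0..1} g = integral {0..1} (\<lambda>x. f x - g x)"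
    by (rule Henstock_Kurzweil_Integration.integral_diff[symmetric]) (auto intro!: integrable_continuous_real assms)
  then show ?thesis using norm_mean_le[of "\<lambda>x. f x - g x" B] assms by (auto intro!: continuous_intros)
qed

lemma mean_has_integral:
  fixes f :: "real \<Rightarrow> 'a::banach"
  assumes "continuous_on {0..1} f"
  shows "(f has_integral integral {0..1} f) {0..1}"
  by (intro integrable_integral integrable_continuous_real assms)

text \<open>If \<open>e (Suc n)\<close> is nearly \<open>(1 - c) * e n\<close>, then
  \<open>c\<close> times the sum telescopes up to the accumulated errors. This removes the means of
  the orbit and of its square, with \<open>c\<close> of order \<open>\<epsilon>\<close>.\<close>

lemma sum_near_rotation_bound:
  fixes e :: "nat \<Rightarrow> complex"
  assumes "\<And>n. cmod (e n) \<le> 1" "\<And>n. cmod (e (Suc n) - e n + c * e n) \<le> \<delta>" "c \<noteq> 0"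
  shows "cmod (\<Sum>i<N. e i) \<le> (2 + real N * \<delta>) / cmod c"
proof -
  have "c * (\<Sum>i<N. e i) = (\<Sum>i<N. e (Suc i) - e i + c * e i) - (e N - e 0)"
    by (simp add: sum.distrib sum_lessThan_telescope sum_distrib_left)
  then have "cmod c * cmod (\<Sum>i<N. e i) = cmod ((\<Sum>i<N. e (Suc i) - e i + c * e i) - (e N - e 0))"
    by (metis norm_mult)
  also have "\<dots> \<le> cmod (\<Sum>i<N. e (Suc i) - e i + c * e i) + (cmod (e N) + cmod (e 0))"
    by (intro order_trans[OF norm_triangle_ineq4] add_left_mono norm_triangle_ineq4)
  also have "cmod (\<Sum>i<N. e (Suc i) - e i + c * e i) \<le> real N * \<delta>"
    using sum_norm_le[of "{..<N}" "\<lambda>i. e (Suc i) - e i + c * e i" "\<lambda>_. \<delta>"] assms(2) by simp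
  finally have "cmod c * cmod (\<Sum>i<N. e i) \<le> 2 + real N * \<delta>"
    using assms(1)[of N] assms(1)[of 0] by linarith
  then show ?thesis using assms(3) by (simp add: field_simps)
qed

lemma one_plus_square_lipschitz:
  fixes z w :: complex
  assumes "cmod z \<le> 1" "cmod w \<le> 1"
  shows "cmod ((1 + z)\<^sup>2 - (1 + w)\<^sup>2) \<le> 4 * cmod (z - w)"
proof -
  have "(1 + z)\<^sup>2 - (1 + w)\<^sup>2 = (2 + z + w) * (z - w)" by (simp add: power2_eq_square algebra_simps)
  moreover have "cmod (2 + z + w) \<le> 4"
    using norm_triangle_ineq[of "2 + z" w] norm_triangle_ineq[of 2 z] assms by simp
  ultimately show ?thesis by (simp add: norm_mult mult_right_mono)
qed

lemma one_plus_square_bound: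
  fixes z :: complex
  assumes "cmod z \<le> 1"
  shows "cmod ((1 + z)\<^sup>2) \<le> 4"
proof -
  have "cmod (1 + z) \<le> 2" using norm_triangle_ineq[of 1 z] assms by simp
  from power_mono[OF this norm_ge_zero, of 2] show ?thesis by (simp add: norm_power)
qed

lemma square_lipschitz:
  fixes z w :: complex
  assumes "cmod z \<le> 1" "cmod w \<le> 1"
  shows "cmod (z\<^sup>2 - w\<^sup>2) \<le> 2 * cmod (z - w)"
proof -
  have "z\<^sup>2 - w\<^sup>2 = (z + w) * (z - w)" by (simp add: power2_eq_square algebra_simps)
  moreover have "cmod (z + w) \<le> 2" using norm_triangle_ineq[of z w] assms by simp
  ultimately show ?thesis by (simp add: norm_mult mult_right_mono)
qed

lemma mult_one_plus_square_lipschitz: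
  fixes z w :: complex
  assumes "cmod z \<le> 1" "cmod w \<le> 1"
  shows "cmod (z * (1 + z)\<^sup>2 - w * (1 + w)\<^sup>2) \<le> 8 * cmod (z - w)"
proof -
  have "z * (1 + z)\<^sup>2 - w * (1 + w)\<^sup>2 = (z - w) * (1 + z)\<^sup>2 + w * ((1 + z)\<^sup>2 - (1 + w)\<^sup>2)"
    by (simp add: algebra_simps)
  also have "cmod \<dots> \<le> cmod (z - w) * cmod ((1 + z)\<^sup>2) + cmod w * cmod ((1 + z)\<^sup>2 - (1 + w)\<^sup>2)"
    by (metis norm_triangle_ineq norm_mult)
  also have "\<dots> \<le> cmod (z - w) * 4 + 1 * (4 * cmod (z - w))"
    using one_plus_square_bound[OF assms(1)] one_plus_square_lipschitz[OF assms] assms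
    by (intro add_mono mult_mono) auto
  finally show ?thesis by simp
qed

lemma geometric_tail_le:
  fixes f :: "nat \<Rightarrow> real"
  assumes "\<And>i. \<bar>f i\<bar> \<le> C / 2 ^ Suc i"
  shows "summable f" "\<bar>suminf f - (\<Sum>i<n. f i)\<bar> \<le> C / 2^n"
proof -
  have g: "(\<lambda>i. C / 2^n * (1/2) ^ Suc i) sums (C / 2^n)" for n
    using sums_mult[OF power_half_series, of "C / 2^n"] by simp
  show s: "summable f"
    by (rule summable_comparison_test'[OF sums_summable[OF g[of 0]], of 0])
       (use assms in \<open>simp add: power_one_over\<close>)
  have "\<bar>\<Sum>i. f (i + n)\<bar> \<le> (\<Sum>i. C / 2^n * (1/2) ^ Suc i)"
  proof -
    have b: "norm (f (i + n)) \<le> C / 2^n * (1/2) ^ Suc i" for i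
      using assms[of "i + n"] by (simp add: power_add power_one_over mult_ac)
    show ?thesis
      using norm_suminf_le[OF b sums_summable[OF g[of n]]] by simp
  qed
  then show "\<bar>suminf f - (\<Sum>i<n. f i)\<bar> \<le> C / 2^n"
    using suminf_minus_initial_segment[OF s, of n] sums_unique[OF g[of n]] by simp
qed

text \<open>The intended drive is \<open>r = \<kappa> q\<close>. One constant \<open>R\<close>
  bounds both size and Lipschitz constant; as \<open>R\<close> is at least 1, its powers are
  monotone and error terms are easy to compare.\<close>

locale doubling_drive =
  fixes r :: "real \<Rightarrow> real" and R :: real
  assumes r_periodic: "r (x + 1) = r x"
    and r_bound: "\<bar>r x\<bar> \<le> R"
    and r_lipschitz: "\<bar>r x - r y\<bar> \<le> R * \<bar>x - y\<bar>"
    and r_mean: "integral {0..1} r = 0"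
    and R_ge_1: "1 \<le> R"
begin

section \<open>Regularity of the drive and its correlation series\<close>

lemma cont_r: "continuous_on S r"
proof (rule continuous_on_subset)
  show "continuous_on UNIV r"
    by (rule lipschitz_on_continuous_on[of R], rule lipschitz_onI)
       (use r_lipschitz R_ge_1 in \<open>auto simp: dist_real_def\<close>)
qed simp

lemma cont_r_scaled: "continuous_on S (\<lambda>x. r (c * x))"
  by (rule continuous_on_compose2[OF cont_r[of UNIV]]) (auto intro!: continuous_intros)

lemma r_periodic_pow2: "r (2^n * (x + 1)) = r (2^n * x)"
  using periodic_add_nat[of r "2^n * x" "2^n", OF r_periodic] by (simp add: algebra_simps)

text \<open>Decorrelation with the unscaled \<open>r\<close> as Lipschitz factor and the scaled one
  as periodic factor; the product of means vanishes.\<close>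

lemma doubling_corr_bound: "\<bar>doubling_corr r s\<bar> \<le> R^2 / 2^s"
proof -
  have "R-lipschitz_on {0..1} r"
    by (rule lipschitz_onI) (use r_lipschitz R_ge_1 in \<open>auto simp: dist_real_def\<close>)
  from doubling_decorrelation[OF cont_r r_periodic r_bound this, of s]
  show ?thesis unfolding r_mean doubling_corr_def by (simp add: mult.commute power2_eq_square)
qed

lemma doubling_corr_bound': "\<bar>doubling_corr r s\<bar> \<le> R^2"
  using order_trans[OF doubling_corr_bound[of s], of "R^2"] by (simp add: divide_le_eq mult_le_cancel_left1)

text \<open>For \<open>r = \<kappa> q\<close> this is \<open>\<kappa>^2\<close> times the
  correlation series of \<open>q\<close> over lags at least 1.\<close>

definition corr_sum :: real where "corr_sum = (\<Sum>s. doubling_corr r (Suc s))"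

lemma corr_sum_tail: "\<bar>corr_sum - (\<Sum>s<n. doubling_corr r (Suc s))\<bar> \<le> R^2 / 2^n"
  and corr_summable: "summable (\<lambda>s. doubling_corr r (Suc s))"
  unfolding corr_sum_def
  using geometric_tail_le[of "\<lambda>s. doubling_corr r (Suc s)" "R^2"] doubling_corr_bound by blast+

lemma corr_sum_bound: "\<bar>corr_sum\<bar> \<le> R^2"
  using corr_sum_tail[of 0] by simp

end

text \<open>\<open>m\<close> is the memory length: a gap of \<open>m\<close> doublings reduces
  correlations to order \<open>1 / 2^m\<close>, hence to order \<open>\<epsilon>^2\<close>. The
  condition on \<open>\<epsilon> * R\<close> keeps every gain close to 1.\<close>

locale small_doubling_cocycle = doubling_drive +
  fixes \<epsilon> :: real and m :: nat
  assumes eps_pos: "0 < \<epsilon>" and eps_R: "\<epsilon> * R \<le> 1/20"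
    and m_large: "1 / 2^m \<le> \<epsilon>^2"
begin

lemmas eps_small' = eps_small[OF eps_pos eps_R R_ge_1]

lemma m_ge_1: "1 \<le> m"
proof (rule ccontr)
  assume "\<not> 1 \<le> m"
  then have "m = 0" by simp
  then have "1 \<le> \<epsilon>^2" using m_large by simp
  moreover have "\<epsilon>^2 \<le> (1/20)^2" using eps_small'(1) eps_pos by (intro power_mono) auto
  ultimately show False by (simp add: power2_eq_square)
qed

text \<open>All error terms are monomials in \<open>R \<ge> 1\<close>, \<open>m \<ge> 1\<close> and
  \<open>\<epsilon> \<le> 1\<close>, so they are compared by their exponents.\<close>

lemma monomial_mono:
  assumes "a \<le> a'" "b \<le> b'" "c' \<le> c"
  shows "R^a * real m^b * \<epsilon>^c \<le> R^a' * real m^b' * \<epsilon>^c'"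
  using assms R_ge_1 m_ge_1 eps_small' eps_pos
  by (intro mult_mono power_increasing power_decreasing mult_nonneg_nonneg) auto

abbreviation z where "z n x \<equiv> disk_orbit r \<epsilon> n x"
abbreviation \<rho> where "\<rho> n x \<equiv> r (2^n * x)"

section \<open>Regularity and slow motion of the disk orbit\<close>

lemma z_in_disk: "cmod (z n x) \<le> 1"
proof (induction n)
  case (Suc n)
  have "step_gain \<epsilon> (\<rho> n x) (z n x) \<noteq> 0"
    using step_gain_near_one(2)[OF eps_pos eps_R R_ge_1 r_bound Suc, of "2^n * x"] by auto
  then show ?case using step_moebius_in_disk[OF Suc] by simp
qed simp

text \<open>One step multiplies the Lipschitz constant by at most 3/2 and adds at most
  \<open>2^n / 4\<close>, less than a doubling in total. Hence \<open>z k\<close> decorrelates at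
  rate \<open>1 / 2^d\<close> from functions of \<open>2^(k + d) * x\<close>.\<close>

lemma z_lipschitz: "cmod (z n x - z n y) \<le> 2^n * \<bar>x - y\<bar>"
proof (induction n)
  case (Suc n)
  have "cmod (z (Suc n) x - z (Suc n) y) \<le> 3/2 * cmod (z n x - z n y) + 5 * \<epsilon> * \<bar>\<rho> n x - \<rho> n y\<bar>"
    using step_moebius_lipschitz[OF eps_pos eps_R R_ge_1 r_bound r_bound z_in_disk z_in_disk] by simp
  also have "\<bar>\<rho> n x - \<rho> n y\<bar> \<le> R * (2^n * \<bar>x - y\<bar>)"
    using r_lipschitz[of "2^n * x" "2^n * y"] by (simp add: abs_mult flip: right_diff_distrib)
  also have "5 * \<epsilon> * (R * (2^n * \<bar>x - y\<bar>)) = 5 * (\<epsilon> * R) * (2^n * \<bar>x - y\<bar>)" by simp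
  also have "\<dots> \<le> 5 * (1/20) * (2^n * \<bar>x - y\<bar>)"
    using eps_R by (intro mult_right_mono) auto
  finally have "cmod (z (Suc n) x - z (Suc n) y) \<le> 3/2 * cmod (z n x - z n y) + 5 * (1/20) * (2^n * \<bar>x - y\<bar>)"
    using eps_pos by (simp add: mult_left_mono)
  moreover have "0 \<le> 2^n * \<bar>x - y\<bar>" by simp
  moreover have "2^Suc n * \<bar>x - y\<bar> = 2 * (2^n * \<bar>x - y\<bar>)" by simp
  ultimately show ?case using Suc by linarith
qed simp

lemma cont_z: "continuous_on S (disk_orbit r \<epsilon> n)"
proof (rule lipschitz_on_continuous_on)
  show "(2^n)-lipschitz_on S (disk_orbit r \<epsilon> n)"
    by (rule lipschitz_onI) (auto simp: dist_norm z_lipschitz)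
qed

lemmas cont = cont_z cont_r_scaled continuous_intros

lemma z_increment: "cmod (z (Suc n) x - z n x) \<le> 5 * R * \<epsilon>"
  using step_moebius_increment[OF eps_pos eps_R R_ge_1 r_bound z_in_disk] by simp

lemma z_expansion: "cmod (z (Suc n) x - z n x - of_real \<epsilon> * step_drift (\<rho> n x) (z n x)) \<le> 20 * R^2 * \<epsilon>^2"
  using step_moebius_expansion[OF eps_pos eps_R R_ge_1 r_bound z_in_disk] by simp

lemma z_increments: "cmod (z (k + d) x - z k x) \<le> real d * (5 * R * \<epsilon>)"
proof (induction d)
  case (Suc d)
  show ?case
    using norm_triangle_ineq[of "z (Suc (k+d)) x - z (k+d) x" "z (k+d) x - z k x"] Suc z_increment[of "k+d" x]
    by (simp add: algebra_simps)
qed simp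

lemma step_drift_lipschitz:
  assumes "\<bar>p\<bar> \<le> R" "cmod u \<le> 1" "cmod w \<le> 1"
  shows "cmod (step_drift p u - step_drift p w) \<le> 4 * R * cmod (u - w)"
proof -
  have "step_drift p u - step_drift p w = \<i> * (of_real (p/2) * ((1 + u)\<^sup>2 - (1 + w)\<^sup>2) - 2 * (u - w))"
    by (simp add: step_drift_def algebra_simps)
  then have "cmod (step_drift p u - step_drift p w) = cmod (of_real (p/2) * ((1 + u)\<^sup>2 - (1 + w)\<^sup>2) - 2 * (u - w))"
    by (simp add: norm_mult)
  also have "\<dots> \<le> \<bar>p/2\<bar> * cmod ((1 + u)\<^sup>2 - (1 + w)\<^sup>2) + 2 * cmod (u - w)"
    using norm_triangle_ineq4[of "of_real (p/2) * ((1 + u)\<^sup>2 - (1 + w)\<^sup>2)" "2 * (u - w)"]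
    by (simp only: norm_mult norm_of_real norm_numeral)
  also have "\<bar>p/2\<bar> * cmod ((1 + u)\<^sup>2 - (1 + w)\<^sup>2) \<le> (R/2) * (4 * cmod (u - w))"
    using assms one_plus_square_lipschitz[OF assms(2,3)] R_ge_1 by (intro mult_mono) auto
  also have "(R/2) * (4 * cmod (u - w)) + 2 * cmod (u - w) \<le> 4 * R * cmod (u - w)"
    using mult_right_mono[OF R_ge_1 norm_ge_zero[of "u - w"]] by simp
  finally show ?thesis by simp
qed

text \<open>Each step has expansion error \<open>20 * R^2 * \<epsilon>^2\<close>, and evaluating its
  drift at \<open>z k\<close> instead of \<open>z (k + d)\<close> costs that amount times
  \<open>d\<close>, because the orbit has moved by at most \<open>5 * R * \<epsilon> * d\<close>.
  The sum is quadratic in \<open>d\<close>.\<close>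

lemma z_frozen_expansion:
  "cmod (z (k + d) x - z k x - of_real \<epsilon> * (\<Sum>j<d. step_drift (\<rho> (k + j) x) (z k x))) \<le> 20 * R^2 * \<epsilon>^2 * (real d)\<^sup>2"
proof (induction d)
  case (Suc d)
  let ?S = "\<Sum>j<d. step_drift (\<rho> (k + j) x) (z k x)"
  let ?n = "k + d"
  let ?A = "z (Suc ?n) x - z ?n x - of_real \<epsilon> * step_drift (\<rho> ?n x) (z ?n x)"
  let ?B = "of_real \<epsilon> * (step_drift (\<rho> ?n x) (z ?n x) - step_drift (\<rho> ?n x) (z k x))"
  let ?C = "z ?n x - z k x - of_real \<epsilon> * ?S"
  have "cmod ?B \<le> \<epsilon> * (4 * R * (real d * (5 * R * \<epsilon>)))"
  proof -
    have "cmod (step_drift (\<rho> ?n x) (z ?n x) - step_drift (\<rho> ?n x) (z k x)) \<le> 4 * R * cmod (z ?n x - z k x)"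
      by (rule step_drift_lipschitz[OF r_bound z_in_disk z_in_disk])
    also have "\<dots> \<le> 4 * R * (real d * (5 * R * \<epsilon>))" using R_ge_1 by (intro mult_left_mono z_increments) auto
    finally show ?thesis using eps_pos by (simp add: norm_mult mult_left_mono)
  qed
  moreover have "cmod (?A + ?B + ?C) \<le> cmod ?A + cmod ?B + cmod ?C"
    by (intro order_trans[OF norm_triangle_ineq] add_mono norm_triangle_ineq) simp
  moreover have "\<epsilon> * (4 * R * (real d * (5 * R * \<epsilon>))) = 20 * R^2 * \<epsilon>^2 * real d" by (simp add: power2_eq_square)
  ultimately have "cmod (?A + ?B + ?C) \<le> 20 * R^2 * \<epsilon>^2 + 20 * R^2 * \<epsilon>^2 * real d + 20 * R^2 * \<epsilon>^2 * (real d)\<^sup>2"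
    using z_expansion[of ?n x] Suc by linarith
  also have "\<dots> = 20 * R^2 * \<epsilon>^2 * (1 + real d + (real d)\<^sup>2)" by (simp add: algebra_simps)
  also have "\<dots> \<le> 20 * R^2 * \<epsilon>^2 * (real (Suc d))\<^sup>2"
  proof (rule mult_left_mono)
    show "1 + real d + (real d)\<^sup>2 \<le> (real (Suc d))\<^sup>2" by (simp add: power2_eq_square algebra_simps)
  qed simp
  finally have "cmod (?A + ?B + ?C) \<le> 20 * R^2 * \<epsilon>^2 * (real (Suc d))\<^sup>2" .
  moreover have "?A + ?B + ?C = z (k + Suc d) x - z k x - of_real \<epsilon> * (\<Sum>j<Suc d. step_drift (\<rho> (k + j) x) (z k x))"
    by (simp add: algebra_simps)
  ultimately show ?case by (simp only:)
qed simp

text \<open>Over the last \<open>m\<close> steps the orbit moves only by \<open>O(m \<epsilon>)\<close>, while its position \<open>m\<close> steps ago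
  is nearly independent of \<open>g (2^n * x)\<close>.\<close>

lemma mean_decouple:
  assumes g: "continuous_on UNIV g" "\<And>x. g (x + 1) = g x" "\<And>x. \<bar>g x\<bar> \<le> B"
    and cF: "continuous_on UNIV F"
    and F: "\<And>u w. cmod u \<le> 1 \<Longrightarrow> cmod w \<le> 1 \<Longrightarrow> cmod (F u - F w) \<le> L * cmod (u - w)"
    and L: "0 \<le> L" and n: "m \<le> n"
  shows "cmod (integral {0..1} (\<lambda>x. g (2^n * x) *\<^sub>R F (z n x)) - integral {0..1} g *\<^sub>R integral {0..1} (\<lambda>x. F (z n x)))
     \<le> 11 * B * L * (R * real m * \<epsilon>)"
\<comment> \<open>The constant 11 is 5 + 1 + 5: replace the orbit by its position \<open>m\<close>
  steps ago, decorrelate, and return to time \<open>n\<close>.\<close>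
proof -
  obtain k where k: "n = k + m" using n le_Suc_ex by (metis add.commute)
  let ?d = "real m * (5 * R * \<epsilon>)"
  have B: "0 \<le> B" using g(3)[of 0] by linarith
  have cFz: "continuous_on S (\<lambda>x. F (z j x))" for j S
    by (rule continuous_on_compose2[OF cF cont_z]) auto
  have cg: "continuous_on S (\<lambda>x. g (c * x))" for c S
    by (rule continuous_on_compose2[OF g(1)]) (auto intro!: continuous_intros)
  have dF: "cmod (F (z n x) - F (z k x)) \<le> L * ?d" for x
    by (rule order_trans[OF F[OF z_in_disk z_in_disk]])
       (use L z_increments[of k m x] k in \<open>auto intro!: mult_left_mono\<close>)
  have 1: "cmod (integral {0..1} (\<lambda>x. g (2^n * x) *\<^sub>R F (z n x)) - integral {0..1} (\<lambda>x. g (2^n * x) *\<^sub>R F (z k x))) \<le> B * (L * ?d)"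
  proof (rule norm_mean_diff_le)
    fix x
    have "cmod (g (2^n * x) *\<^sub>R F (z n x) - g (2^n * x) *\<^sub>R F (z k x)) = \<bar>g (2^n * x)\<bar> * cmod (F (z n x) - F (z k x))"
      by (simp flip: scaleR_diff_right)
    also have "\<dots> \<le> B * (L * ?d)" using g(3) dF B by (intro mult_mono) auto
    finally show "cmod (g (2^n * x) *\<^sub>R F (z n x) - g (2^n * x) *\<^sub>R F (z k x)) \<le> B * (L * ?d)" .
  qed (auto intro!: continuous_intros cFz cg)
  have 2: "cmod (integral {0..1} (\<lambda>x. g (2^n * x) *\<^sub>R F (z k x)) - integral {0..1} g *\<^sub>R integral {0..1} (\<lambda>x. F (z k x)))
     \<le> (L * 2^k) * B / 2^n"
  proof (rule doubling_decorrelation[OF g])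
    show "(L * 2^k)-lipschitz_on {0..1} (\<lambda>x. F (z k x))"
    proof (rule lipschitz_onI)
      fix x y :: real
      have "cmod (F (z k x) - F (z k y)) \<le> L * (2^k * \<bar>x - y\<bar>)"
        by (rule order_trans[OF F[OF z_in_disk z_in_disk]]) (use L z_lipschitz in \<open>auto intro!: mult_left_mono\<close>)
      then show "dist (F (z k x)) (F (z k y)) \<le> L * 2^k * dist x y" by (simp add: dist_norm)
    qed (use L in simp)
  qed
  have mg: "\<bar>integral {0..1} g\<bar> \<le> B"
    using norm_mean_le[of g B] g continuous_on_subset[OF g(1)] by auto
  have "cmod (integral {0..1} (\<lambda>x. F (z k x)) - integral {0..1} (\<lambda>x. F (z n x))) \<le> L * ?d"
    by (rule norm_mean_diff_le) (use dF in \<open>auto intro!: cFz simp: norm_minus_commute\<close>)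
  then have 3: "cmod (integral {0..1} g *\<^sub>R integral {0..1} (\<lambda>x. F (z k x)) - integral {0..1} g *\<^sub>R integral {0..1} (\<lambda>x. F (z n x))) \<le> B * (L * ?d)"
    using mg B by (simp add: mult_mono flip: scaleR_diff_right)
  have "(L * 2^k) * B / 2^n = B * L * (1 / 2^m)" unfolding k by (simp add: power_add)
  also have "\<dots> \<le> B * L * (R^0 * real m^0 * \<epsilon>^2)" using m_large B L by (intro mult_left_mono) auto
  also have "\<dots> \<le> B * L * (R^1 * real m^1 * \<epsilon>^1)" using B L by (intro mult_left_mono monomial_mono) auto
  finally have 4: "(L * 2^k) * B / 2^n \<le> B * L * (R * real m * \<epsilon>)" by simp
  have "B * (L * ?d) = 5 * (B * L * (R * real m * \<epsilon>))" by simp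
  moreover have "11 * B * L * (R * real m * \<epsilon>) = 11 * (B * L * (R * real m * \<epsilon>))" by simp
  moreover have "cmod (a - d) \<le> cmod (a - b) + cmod (b - c) + cmod (c - d)" for a b c d
    using norm_triangle_ineq[of "a - b" "b - c"] norm_triangle_ineq[of "a - c" "c - d"] by simp
  ultimately show ?thesis using 1 2 3 4 by (smt (verit))
qed

text \<open>The mean of \<open>r\<close> vanishes, and the Lipschitz constant \<open>2^k\<close> of
  \<open>z k\<close> cancels all but \<open>d\<close> of the doublings.\<close>

lemma mean_drive_old_orbit:
  "cmod (integral {0..1} (\<lambda>x. \<rho> (k + d) x *\<^sub>R z k x)) \<le> R / 2^d"
proof -
  have "(2^k)-lipschitz_on {0..1} (z k)"
    by (rule lipschitz_onI) (auto simp: dist_norm z_lipschitz)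
  from doubling_decorrelation[OF cont_r r_periodic r_bound this, of "k + d"]
  show ?thesis unfolding r_mean by (simp add: power_add)
qed

lemma mean_drive_pair:
  assumes "1 \<le> s" "s \<le> 2 * m"
  shows "cmod (integral {0..1} (\<lambda>x. (\<rho> (k + 2*m) x * \<rho> (k + (2*m - s)) x) *\<^sub>R (1 + z k x)\<^sup>2)
     - doubling_corr r s *\<^sub>R integral {0..1} (\<lambda>x. (1 + z k x)\<^sup>2)) \<le> 12 * R^2 * \<epsilon>^2"
proof -
  let ?n = "k + 2*m" and ?j = "k + (2*m - s)"
  define W where "W = (\<lambda>x. (1 + z k x)\<^sup>2)"
  have cW: "continuous_on S W" for S unfolding W_def by (intro cont)
  have W4: "cmod (W x) \<le> 4" for x unfolding W_def by (rule one_plus_square_bound[OF z_in_disk])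
  have WL: "cmod (W x - W y) \<le> 4 * 2^k * \<bar>x - y\<bar>" for x y
    unfolding W_def using one_plus_square_lipschitz[OF z_in_disk z_in_disk, of k x k y] z_lipschitz[of k x y] by simp
  have R2: "0 \<le> R^2" by simp
  have "cmod (integral {0..1} (\<lambda>x. (\<rho> ?n x * \<rho> ?j x) *\<^sub>R W x) - doubling_corr r s *\<^sub>R integral {0..1} W) \<le> 12 * R^2 * (1 / 2^m)"
  proof (cases "s \<le> m")
    case True
    let ?g = "\<lambda>y. r y * r (2^s * y)"
    have cg: "continuous_on UNIV ?g" by (intro continuous_intros cont_r cont_r_scaled)
    have pg: "?g (x + 1) = ?g x" for x using r_periodic r_periodic_pow2 by simp
    have bg: "\<bar>?g x\<bar> \<le> R^2" for x
      unfolding abs_mult power2_eq_square using r_bound R_ge_1 by (intro mult_mono) auto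
    have L: "(4 * 2^k)-lipschitz_on {0..1} W" by (rule lipschitz_onI) (use WL in \<open>auto simp: dist_norm\<close>)
    have e: "r (2^?j * x) * r (2^s * (2^?j * x)) = \<rho> ?n x * \<rho> ?j x" for x
    proof -
      have "2^s * (2^?j * x) = 2^(s + ?j) * x" by (simp only: power_add mult.assoc)
      moreover have "s + ?j = ?n" using assms by simp
      ultimately have "2^s * (2^?j * x) = 2^?n * x" by simp
      then show ?thesis by (simp only: mult.commute[of "r (2^?j * x)"])
    qed
    have "cmod (integral {0..1} (\<lambda>x. (\<rho> ?n x * \<rho> ?j x) *\<^sub>R W x) - doubling_corr r s *\<^sub>R integral {0..1} W)
        \<le> (4 * 2^k) * R^2 / 2^?j"
      using doubling_decorrelation[OF cg pg bg L, of ?j] unfolding e doubling_corr_def .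
    also have "\<dots> = 4 * R^2 * (1 / 2^(2*m - s))" by (simp add: power_add)
    also have "\<dots> \<le> 4 * R^2 * (1 / 2^m)"
      using True R2 by (intro mult_left_mono divide_left_mono power_increasing) auto
    also have "\<dots> \<le> 12 * R^2 * (1 / 2^m)" using R2 by (intro mult_right_mono) auto
    finally show ?thesis .
  next
    case False
    have kj: "k \<le> ?j" by simp
    have L: "(8 * R * 2^?j)-lipschitz_on {0..1} (\<lambda>x. \<rho> ?j x *\<^sub>R W x)"
    proof (rule lipschitz_onI)
      fix x y :: real
      have "\<rho> ?j x *\<^sub>R W x - \<rho> ?j y *\<^sub>R W y = (\<rho> ?j x - \<rho> ?j y) *\<^sub>R W x + \<rho> ?j y *\<^sub>R (W x - W y)"
        by (simp add: algebra_simps)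
      also have "cmod \<dots> \<le> \<bar>\<rho> ?j x - \<rho> ?j y\<bar> * cmod (W x) + \<bar>\<rho> ?j y\<bar> * cmod (W x - W y)"
        by (rule order_trans[OF norm_triangle_ineq]) simp
      also have "\<dots> \<le> (R * (2^?j * \<bar>x - y\<bar>)) * 4 + R * (4 * 2^?j * \<bar>x - y\<bar>)"
      proof (intro add_mono mult_mono)
        show "\<bar>\<rho> ?j x - \<rho> ?j y\<bar> \<le> R * (2^?j * \<bar>x - y\<bar>)"
          using r_lipschitz[of "2^?j * x" "2^?j * y"] by (simp add: abs_mult flip: right_diff_distrib)
        have "4 * 2^k * \<bar>x - y\<bar> \<le> 4 * 2^?j * \<bar>x - y\<bar>"
          using kj by (intro mult_right_mono mult_left_mono power_increasing) auto
        then show "cmod (W x - W y) \<le> 4 * 2^?j * \<bar>x - y\<bar>" using WL[of x y] by linarith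
      qed (use r_bound R_ge_1 W4 in auto)
      also have "\<dots> = 8 * R * 2^?j * \<bar>x - y\<bar>" by simp
      finally show "dist (\<rho> ?j x *\<^sub>R W x) (\<rho> ?j y *\<^sub>R W y) \<le> 8 * R * 2^?j * dist x y"
        by (simp add: dist_norm)
    qed (use R_ge_1 in simp)
    have "cmod (integral {0..1} (\<lambda>x. (\<rho> ?n x * \<rho> ?j x) *\<^sub>R W x)) \<le> (8 * R * 2^?j) * R / 2^?n"
      using doubling_decorrelation[OF cont_r r_periodic r_bound L, of ?n] unfolding r_mean by simp
    also have "(8 * R * 2^?j) * R / 2^?n = 8 * R^2 * (1 / 2^s)"
    proof -
      have "(2::real)^?n = 2^?j * 2^s" using assms by (simp flip: power_add)
      then show ?thesis by (simp add: power2_eq_square)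
    qed
    also have "\<dots> \<le> 8 * R^2 * (1 / 2^m)"
      using False R2 by (intro mult_left_mono divide_left_mono power_increasing) auto
    finally have 1: "cmod (integral {0..1} (\<lambda>x. (\<rho> ?n x * \<rho> ?j x) *\<^sub>R W x)) \<le> 8 * R^2 * (1 / 2^m)" .
    have "\<bar>doubling_corr r s\<bar> * cmod (integral {0..1} W) \<le> (R^2 / 2^m) * 4"
    proof (rule mult_mono)
      have "R^2 / 2^s \<le> R^2 / 2^m" using False R2 by (intro divide_left_mono power_increasing) auto
      then show "\<bar>doubling_corr r s\<bar> \<le> R^2 / 2^m" using doubling_corr_bound[of s] by linarith
      show "cmod (integral {0..1} W) \<le> 4" by (rule norm_mean_le[OF cW W4])
    qed (use R2 in auto)
    then have 2: "cmod (doubling_corr r s *\<^sub>R integral {0..1} W) \<le> 4 * R^2 * (1 / 2^m)" by (simp add: mult.commute)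
    show ?thesis
      by (rule order_trans[OF norm_triangle_ineq4]) (use 1 2 in linarith)
  qed
  also have "12 * R^2 * (1 / 2^m) \<le> 12 * R^2 * \<epsilon>^2" using m_large by (intro mult_left_mono) auto
  finally show ?thesis by (simp only: W_def)
qed

lemma mean_drive_orbit:
  assumes "2 * m \<le> n"
  shows "cmod (integral {0..1} (\<lambda>x. \<rho> n x *\<^sub>R z n x)
      - \<i> * of_real (\<epsilon>/2 * corr_sum) * integral {0..1} (\<lambda>x. (1 + z n x)\<^sup>2)) \<le> 200 * (R^3 * real m^2 * \<epsilon>^2)"
proof -
  obtain k where k: "n = k + 2 * m" using assms le_Suc_ex by (metis add.commute)
  let ?u = "R^3 * real m^2 * \<epsilon>^2"
  let ?K = "2 * m"
  define W where "W = (\<lambda>x. (1 + z k x)\<^sup>2)"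
  have cW: "continuous_on S W" for S unfolding W_def by (intro cont)
  \<comment> \<open>The factor in front of \<open>z k\<close> collects the rotation parts of all
    \<open>2 * m\<close> drifts; \<open>Suc i\<close> is the lag between the two samples.\<close>
  define G where "G = (\<lambda>x. (1 - \<i> * of_real (4 * real m * \<epsilon>)) * (\<rho> n x *\<^sub>R z k x)
     + \<i> * of_real (\<epsilon>/2) * (\<Sum>i<?K. (\<rho> (k + ?K) x * \<rho> (k + (?K - Suc i)) x) *\<^sub>R W x))"
  have G: "\<rho> n x *\<^sub>R (z k x + of_real \<epsilon> * (\<Sum>j<?K. step_drift (\<rho> (k + j) x) (z k x))) = G x" for x
  proof -
    have "(\<Sum>j<?K. step_drift (\<rho> (k + j) x) (z k x))
       = (\<Sum>i<?K. step_drift (\<rho> (k + (?K - Suc i)) x) (z k x))"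
      by (rule sum.nat_diff_reindex[symmetric])
    also have "\<dots> = (\<Sum>i<?K. \<i> * of_real (\<rho> (k + (?K - Suc i)) x / 2) * W x) - \<i> * of_real (4 * real m) * z k x"
      by (simp add: step_drift_def W_def right_diff_distrib sum_subtractf mult.assoc)
    finally have "\<rho> n x *\<^sub>R (z k x + of_real \<epsilon> * (\<Sum>j<?K. step_drift (\<rho> (k + j) x) (z k x)))
       = of_real (\<rho> n x) * (z k x + of_real \<epsilon> * ((\<Sum>i<?K. \<i> * of_real (\<rho> (k + (?K - Suc i)) x / 2) * W x) - \<i> * of_real (4 * real m) * z k x))"
      by (simp only: scaleR_conv_of_real)
    also have "\<dots> = (1 - \<i> * of_real (4 * real m * \<epsilon>)) * (of_real (\<rho> n x) * z k x)
      + \<i> * of_real (\<epsilon>/2) * (\<Sum>i<?K. of_real (\<rho> n x) * of_real (\<rho> (k + (?K - Suc i)) x) * W x)"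
      by (simp add: sum_distrib_left algebra_simps)
    finally show ?thesis by (simp only: G_def k scaleR_conv_of_real of_real_mult)
  qed
  have cG: "continuous_on S G" for S unfolding G_def by (intro cont cW)
  have 1: "cmod (integral {0..1} (\<lambda>x. \<rho> n x *\<^sub>R z n x) - integral {0..1} G) \<le> 80 * ?u"
  proof (rule norm_mean_diff_le)
    fix x
    have "cmod (\<rho> n x *\<^sub>R z n x - G x)
      = \<bar>\<rho> n x\<bar> * cmod (z (k + ?K) x - z k x - of_real \<epsilon> * (\<Sum>j<?K. step_drift (\<rho> (k + j) x) (z k x)))"
      unfolding G[symmetric] scaleR_diff_right[symmetric] norm_scaleR by (simp add: k diff_diff_eq)
    also have "\<dots> \<le> R * (20 * R^2 * \<epsilon>^2 * (real ?K)\<^sup>2)"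
      using r_bound z_frozen_expansion[of k ?K x] R_ge_1 by (intro mult_mono) auto
    also have "\<dots> = 80 * ?u" by (simp add: power2_eq_square power3_eq_cube)
    finally show "cmod (\<rho> n x *\<^sub>R z n x - G x) \<le> 80 * ?u" .
  qed (auto intro!: cont cG)
  let ?A = "integral {0..1} (\<lambda>x. \<rho> n x *\<^sub>R z k x)"
  let ?P = "\<lambda>i. integral {0..1} (\<lambda>x. (\<rho> (k + ?K) x * \<rho> (k + (?K - Suc i)) x) *\<^sub>R W x)"
  let ?EW = "integral {0..1} W"
  have iG: "integral {0..1} G = (1 - \<i> * of_real (4 * real m * \<epsilon>)) * ?A + \<i> * of_real (\<epsilon>/2) * (\<Sum>i<?K. ?P i)"
    unfolding G_def
    by (intro integral_unique has_integral_add has_integral_mult_right has_integral_sum mean_has_integral finite_lessThan cont cW)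
  have "cmod ((1 - \<i> * of_real (4 * real m * \<epsilon>)) * ?A) \<le> (1 + 4 * real m * \<epsilon>) * (R / 2^?K)"
    unfolding norm_mult[of _ ?A]
  proof (rule mult_mono)
    show "cmod (1 - \<i> * of_real (4 * real m * \<epsilon>)) \<le> 1 + 4 * real m * \<epsilon>"
      by (rule order_trans[OF norm_triangle_ineq4]) (use eps_pos in \<open>simp add: norm_mult\<close>)
    show "cmod ?A \<le> R / 2^?K" unfolding k by (rule mean_drive_old_orbit)
  qed (use eps_pos in auto)
  \<comment> \<open>A window of twice the memory length squares the decorrelation factor.\<close>
  also have "R / 2^?K \<le> R * \<epsilon>^4"
  proof -
    have "R / 2^?K = R * (1/2^m)^2" by (simp add: power_mult power_divide power_mult_distrib mult.commute[of 2])
    also have "\<dots> \<le> R * (\<epsilon>^2)^2" using m_large R_ge_1 by (intro mult_left_mono power_mono) auto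
    finally show ?thesis by (simp flip: power_mult)
  qed
  finally have "cmod ((1 - \<i> * of_real (4 * real m * \<epsilon>)) * ?A) \<le> (1 + 4 * real m * \<epsilon>) * (R * \<epsilon>^4)"
    using eps_pos by (simp add: mult_left_mono)
  also have "\<dots> = R^1 * real m^0 * \<epsilon>^4 + 4 * (R^1 * real m^1 * \<epsilon>^5)"
    by (simp add: distrib_right numeral_eq_Suc)
  also have "\<dots> \<le> 5 * ?u"
    using monomial_mono[of 1 3 0 2 2 4] monomial_mono[of 1 3 1 2 2 5] by simp
  finally have 2: "cmod ((1 - \<i> * of_real (4 * real m * \<epsilon>)) * ?A) \<le> 5 * ?u" .
  have "cmod ((\<Sum>i<?K. ?P i) - (\<Sum>i<?K. doubling_corr r (Suc i)) *\<^sub>R ?EW) \<le> (\<Sum>i<?K. 12 * R^2 * \<epsilon>^2)"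
    unfolding scaleR_sum_left sum_subtractf[symmetric]
  proof (rule sum_norm_le)
    fix i assume "i \<in> {..<?K}"
    then show "cmod (?P i - doubling_corr r (Suc i) *\<^sub>R ?EW) \<le> 12 * R^2 * \<epsilon>^2"
      unfolding W_def by (intro mean_drive_pair) auto
  qed
  also have "\<dots> = 24 * (R^2 * real m^1 * \<epsilon>^2)" by simp
  also have "\<dots> \<le> 24 * ?u" by (intro mult_left_mono monomial_mono) auto
  finally have 3: "cmod ((\<Sum>i<?K. ?P i) - (\<Sum>i<?K. doubling_corr r (Suc i)) *\<^sub>R ?EW) \<le> 24 * ?u" .
  have EW4: "cmod ?EW \<le> 4"
    by (rule norm_mean_le[OF cW]) (simp add: W_def one_plus_square_bound z_in_disk)
  \<comment> \<open>The window sees only finitely many lags; the missing tail of the series is of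
    order \<open>\<epsilon>^2\<close>.\<close>
  have "\<bar>(\<Sum>i<?K. doubling_corr r (Suc i)) - corr_sum\<bar> \<le> R^2 * (1 / 2^m)"
  proof -
    have "R^2 / 2^?K \<le> R^2 / 2^m" by (intro divide_left_mono power_increasing) auto
    then show ?thesis using corr_sum_tail[of ?K] by simp
  qed
  also have "\<dots> \<le> R^2 * \<epsilon>^2" using m_large by (intro mult_left_mono) auto
  finally have "\<bar>(\<Sum>i<?K. doubling_corr r (Suc i)) - corr_sum\<bar> * cmod ?EW \<le> R^2 * \<epsilon>^2 * 4"
    using EW4 by (intro mult_mono) auto
  also have "R^2 * \<epsilon>^2 * 4 \<le> 4 * ?u" using monomial_mono[of 2 3 0 2 2 2] by (simp add: mult_ac)
  finally have 4: "cmod ((\<Sum>i<?K. doubling_corr r (Suc i)) *\<^sub>R ?EW - corr_sum *\<^sub>R ?EW) \<le> 4 * ?u"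
    unfolding scaleR_diff_left[symmetric] norm_scaleR .
  \<comment> \<open>Returning from time \<open>k\<close> to time \<open>n\<close> moves the orbit by
    order \<open>m * \<epsilon>\<close>, which the outer factor \<open>\<epsilon>/2\<close> makes an
    error of order \<open>m * \<epsilon>^2\<close>.\<close>
  have "cmod (?EW - integral {0..1} (\<lambda>x. (1 + z n x)\<^sup>2)) \<le> 4 * (real ?K * (5 * R * \<epsilon>))"
  proof (rule norm_mean_diff_le)
    fix x
    have "cmod (W x - (1 + z n x)\<^sup>2) \<le> 4 * cmod (z (k + ?K) x - z k x)"
      unfolding W_def k using one_plus_square_lipschitz[OF z_in_disk z_in_disk] by (metis norm_minus_commute)
    then show "cmod (W x - (1 + z n x)\<^sup>2) \<le> 4 * (real ?K * (5 * R * \<epsilon>))" using z_increments[of k ?K x] by linarith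
  qed (auto intro!: cont cW)
  then have "\<bar>corr_sum\<bar> * cmod (?EW - integral {0..1} (\<lambda>x. (1 + z n x)\<^sup>2)) \<le> R^2 * (4 * (real ?K * (5 * R * \<epsilon>)))"
    using corr_sum_bound by (intro mult_mono) auto
  also have "\<dots> = 40 * (R^3 * real m^1 * \<epsilon>^1)" by (simp add: power2_eq_square power3_eq_cube)
  finally have 5: "cmod (corr_sum *\<^sub>R ?EW - corr_sum *\<^sub>R integral {0..1} (\<lambda>x. (1 + z n x)\<^sup>2)) \<le> 40 * (R^3 * real m^1 * \<epsilon>^1)"
    unfolding scaleR_diff_right[symmetric] norm_scaleR .
  let ?EWn = "integral {0..1} (\<lambda>x. (1 + z n x)\<^sup>2)"
  have tri: "cmod (a - d) \<le> cmod (a - b) + cmod (b - c) + cmod (c - d)" for a b c d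
    using norm_triangle_ineq[of "a - b" "b - c"] norm_triangle_ineq[of "a - c" "c - d"] by simp
  have u0: "0 \<le> ?u" using R_ge_1 by simp
  have "cmod ((\<Sum>i<?K. ?P i) - corr_sum *\<^sub>R ?EWn) \<le> 28 * ?u + 40 * (R^3 * real m^1 * \<epsilon>^1)"
    using tri[of "\<Sum>i<?K. ?P i" "corr_sum *\<^sub>R ?EWn" "(\<Sum>i<?K. doubling_corr r (Suc i)) *\<^sub>R ?EW" "corr_sum *\<^sub>R ?EW"] 3 4 5
    by linarith
  then have "\<epsilon>/2 * cmod ((\<Sum>i<?K. ?P i) - corr_sum *\<^sub>R ?EWn) \<le> \<epsilon>/2 * (28 * ?u + 40 * (R^3 * real m^1 * \<epsilon>^1))"
    using eps_pos by (intro mult_left_mono) auto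
  also have "\<dots> = \<epsilon> * (14 * ?u) + 20 * (R^3 * real m^1 * \<epsilon>^2)" by (simp add: power2_eq_square algebra_simps)
  also have "\<dots> \<le> 1 * (14 * ?u) + 20 * ?u"
  proof (rule add_mono)
    show "\<epsilon> * (14 * ?u) \<le> 1 * (14 * ?u)" using u0 eps_small'(1) by (intro mult_right_mono) auto
    show "20 * (R^3 * real m^1 * \<epsilon>^2) \<le> 20 * ?u" by (intro mult_left_mono monomial_mono) auto
  qed
  finally have 6: "cmod (\<i> * of_real (\<epsilon>/2) * (\<Sum>i<?K. ?P i) - \<i> * of_real (\<epsilon>/2 * corr_sum) * ?EWn) \<le> 34 * ?u"
  proof -
    assume a: "\<epsilon>/2 * cmod ((\<Sum>i<?K. ?P i) - corr_sum *\<^sub>R ?EWn) \<le> 1 * (14 * ?u) + 20 * ?u"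
    have "\<i> * of_real (\<epsilon>/2) * (\<Sum>i<?K. ?P i) - \<i> * of_real (\<epsilon>/2 * corr_sum) * ?EWn
      = \<i> * of_real (\<epsilon>/2) * ((\<Sum>i<?K. ?P i) - corr_sum *\<^sub>R ?EWn)"
      by (simp add: scaleR_conv_of_real algebra_simps)
    then have "cmod (\<i> * of_real (\<epsilon>/2) * (\<Sum>i<?K. ?P i) - \<i> * of_real (\<epsilon>/2 * corr_sum) * ?EWn)
      = \<epsilon>/2 * cmod ((\<Sum>i<?K. ?P i) - corr_sum *\<^sub>R ?EWn)"
      using eps_pos by (simp only: norm_mult norm_ii norm_of_real)
    then show ?thesis using a by linarith
  qed
  have "cmod (integral {0..1} G - \<i> * of_real (\<epsilon>/2 * corr_sum) * ?EWn) \<le> 39 * ?u"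
    unfolding iG
    using norm_triangle_ineq[of "(1 - \<i> * of_real (4 * real m * \<epsilon>)) * ?A" "\<i> * of_real (\<epsilon>/2) * (\<Sum>i<?K. ?P i) - \<i> * of_real (\<epsilon>/2 * corr_sum) * ?EWn"] 2 6
    by (simp only: add_diff_eq)
  then show ?thesis
    using tri[of "integral {0..1} (\<lambda>x. \<rho> n x *\<^sub>R z n x)" "\<i> * of_real (\<epsilon>/2 * corr_sum) * ?EWn" "integral {0..1} G" "integral {0..1} G"] 1 u0
    by simp
qed

end

section \<open>Averages along the orbit\<close>

context small_doubling_cocycle
begin

text \<open>In the mean, the forcing decouples from the orbit and vanishes to leading order with the
  mean of \<open>r\<close>. Only the rotation remains.\<close>

lemma mean_z_step:
  assumes n: "m \<le> n"
  shows "cmod (integral {0..1} (z (Suc n)) - integral {0..1} (z n)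
     + \<i> * of_real (2 * \<epsilon>) * integral {0..1} (z n)) \<le> 42 * (R^2 * real m * \<epsilon>^2)"
proof -
  define Q where "Q = integral {0..1} (\<lambda>x. \<rho> n x *\<^sub>R (1 + z n x)\<^sup>2)"
  define G where "G = (\<lambda>x. z n x + (\<i> * of_real (\<epsilon>/2) * (\<rho> n x *\<^sub>R (1 + z n x)\<^sup>2) - \<i> * of_real (2 * \<epsilon>) * z n x))"
  have G: "G x = z n x + of_real \<epsilon> * step_drift (\<rho> n x) (z n x)" for x
    by (simp add: G_def step_drift_def scaleR_conv_of_real algebra_simps)
  have cG: "continuous_on S G" for S unfolding G_def by (intro cont)
  have 1: "cmod (integral {0..1} (z (Suc n)) - integral {0..1} G) \<le> 20 * R^2 * \<epsilon>^2"
  proof (rule norm_mean_diff_le)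
    show "cmod (z (Suc n) x - G x) \<le> 20 * R^2 * \<epsilon>^2" for x
      unfolding G using z_expansion[of n x] by (simp only: diff_diff_eq)
  qed (intro cont_z cG)+
  have iG: "integral {0..1} G = integral {0..1} (z n) + (\<i> * of_real (\<epsilon>/2) * Q - \<i> * of_real (2 * \<epsilon>) * integral {0..1} (z n))"
    unfolding G_def Q_def
    by (intro integral_unique has_integral_add has_integral_diff has_integral_mult_right mean_has_integral cont)
  have Q: "cmod Q \<le> 44 * R * (R * real m * \<epsilon>)"
    using mean_decouple[OF cont_r r_periodic r_bound, of "\<lambda>w. (1 + w)\<^sup>2" 4 n] n one_plus_square_lipschitz
    unfolding r_mean Q_def by (force intro!: continuous_intros)
  have "cmod (\<i> * of_real (\<epsilon>/2) * Q) = \<epsilon>/2 * cmod Q" using eps_pos by (simp add: norm_mult norm_divide)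
  also have "\<dots> \<le> \<epsilon>/2 * (44 * R * (R * real m * \<epsilon>))" using Q eps_pos by (intro mult_left_mono) auto
  also have "\<dots> = 22 * (R^2 * real m * \<epsilon>^2)" by (simp add: power2_eq_square)
  finally have 2: "cmod (\<i> * of_real (\<epsilon>/2) * Q) \<le> 22 * (R^2 * real m * \<epsilon>^2)" .
  have 3: "20 * R^2 * \<epsilon>^2 \<le> 20 * (R^2 * real m * \<epsilon>^2)"
    using monomial_mono[of 2 2 0 1 2 2] by simp
  have "integral {0..1} (z (Suc n)) - integral {0..1} (z n) + \<i> * of_real (2 * \<epsilon>) * integral {0..1} (z n)
     = (integral {0..1} (z (Suc n)) - integral {0..1} G) + \<i> * of_real (\<epsilon>/2) * Q"
    unfolding iG by simp
  also have "cmod \<dots> \<le> 20 * R^2 * \<epsilon>^2 + 22 * (R^2 * real m * \<epsilon>^2)"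
    by (rule order_trans[OF norm_triangle_ineq add_mono[OF 1 2]])
  also have "\<dots> \<le> 42 * (R^2 * real m * \<epsilon>^2)" using 3 by linarith
  finally show ?thesis .
qed

text \<open>Squaring doubles the rotation speed. The forcing is now multiplied by
  \<open>2 * z n x\<close>, and its mean is again small by decoupling.\<close>

lemma mean_z_square_step:
  assumes n: "m \<le> n"
  shows "cmod (integral {0..1} (\<lambda>x. (z (Suc n) x)\<^sup>2) - integral {0..1} (\<lambda>x. (z n x)\<^sup>2)
     + \<i> * of_real (4 * \<epsilon>) * integral {0..1} (\<lambda>x. (z n x)\<^sup>2)) \<le> 153 * (R^2 * real m * \<epsilon>^2)"
proof -
  define Q where "Q = integral {0..1} (\<lambda>x. \<rho> n x *\<^sub>R (z n x * (1 + z n x)\<^sup>2))"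
  let ?Z = "integral {0..1} (\<lambda>x. (z n x)\<^sup>2)"
  define G where "G = (\<lambda>x. (z n x)\<^sup>2 + (\<i> * of_real \<epsilon> * (\<rho> n x *\<^sub>R (z n x * (1 + z n x)\<^sup>2)) - \<i> * of_real (4 * \<epsilon>) * (z n x)\<^sup>2))"
  have G: "G x = (z n x)\<^sup>2 + 2 * z n x * (of_real \<epsilon> * step_drift (\<rho> n x) (z n x))" for x
    by (simp add: G_def step_drift_def scaleR_conv_of_real power2_eq_square algebra_simps)
  have cG: "continuous_on S G" for S unfolding G_def by (intro cont)
  have 1: "cmod (integral {0..1} (\<lambda>x. (z (Suc n) x)\<^sup>2) - integral {0..1} G) \<le> 65 * R^2 * \<epsilon>^2"
  proof (rule norm_mean_diff_le)
    fix x
    let ?w = "z (Suc n) x" and ?v = "z n x" and ?d = "of_real \<epsilon> * step_drift (\<rho> n x) (z n x)"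
    have "?w\<^sup>2 - G x = 2 * ?v * (?w - ?v - ?d) + (?w - ?v)\<^sup>2"
      unfolding G by (simp add: power2_eq_square algebra_simps)
    also have "cmod \<dots> \<le> 2 * cmod ?v * cmod (?w - ?v - ?d) + (cmod (?w - ?v))\<^sup>2"
      by (rule order_trans[OF norm_triangle_ineq]) (simp add: norm_mult norm_power)
    also have "\<dots> \<le> 2 * 1 * (20 * R^2 * \<epsilon>^2) + (5 * R * \<epsilon>)\<^sup>2"
      using z_in_disk z_expansion z_increment by (intro add_mono mult_mono power_mono) auto
    also have "\<dots> = 65 * R^2 * \<epsilon>^2" by (simp add: power2_eq_square)
    finally show "cmod (?w\<^sup>2 - G x) \<le> 65 * R^2 * \<epsilon>^2" .
  qed (intro cG cont)+
  have iG: "integral {0..1} G = ?Z + (\<i> * of_real \<epsilon> * Q - \<i> * of_real (4 * \<epsilon>) * ?Z)"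
    unfolding G_def Q_def
    by (intro integral_unique has_integral_add has_integral_diff has_integral_mult_right mean_has_integral cont)
  have Q: "cmod Q \<le> 88 * R * (R * real m * \<epsilon>)"
    using mean_decouple[OF cont_r r_periodic r_bound, of "\<lambda>w. w * (1 + w)\<^sup>2" 8 n] n mult_one_plus_square_lipschitz
    unfolding r_mean Q_def by (force intro!: continuous_intros)
  have "cmod (\<i> * of_real \<epsilon> * Q) = \<epsilon> * cmod Q" using eps_pos by (simp add: norm_mult)
  also have "\<dots> \<le> \<epsilon> * (88 * R * (R * real m * \<epsilon>))" using Q eps_pos by (intro mult_left_mono) auto
  also have "\<dots> = 88 * (R^2 * real m * \<epsilon>^2)" by (simp add: power2_eq_square)
  finally have 2: "cmod (\<i> * of_real \<epsilon> * Q) \<le> 88 * (R^2 * real m * \<epsilon>^2)" .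
  have 3: "65 * R^2 * \<epsilon>^2 \<le> 65 * (R^2 * real m * \<epsilon>^2)"
    using monomial_mono[of 2 2 0 1 2 2] by simp
  have "integral {0..1} (\<lambda>x. (z (Suc n) x)\<^sup>2) - ?Z + \<i> * of_real (4 * \<epsilon>) * ?Z
     = (integral {0..1} (\<lambda>x. (z (Suc n) x)\<^sup>2) - integral {0..1} G) + \<i> * of_real \<epsilon> * Q"
    unfolding iG by simp
  also have "cmod \<dots> \<le> 65 * R^2 * \<epsilon>^2 + 88 * (R^2 * real m * \<epsilon>^2)"
    by (rule order_trans[OF norm_triangle_ineq add_mono[OF 1 2]])
  also have "\<dots> \<le> 153 * (R^2 * real m * \<epsilon>^2)" using 3 by linarith
  finally show ?thesis .
qed

section \<open>The logarithmic gain and its growth rate\<close>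

definition log_gain :: "nat \<Rightarrow> real \<Rightarrow> real" where
  "log_gain n x = ln (cmod (orbit_gain r \<epsilon> n x))"

lemma orbit_gain_bounds: "cmod (orbit_gain r \<epsilon> n x - 1) \<le> 3/20" "17/20 \<le> cmod (orbit_gain r \<epsilon> n x)"
  using step_gain_near_one[OF eps_pos eps_R R_ge_1 r_bound z_in_disk, of "2^n * x" n x] eps_R
  unfolding orbit_gain_def by (simp_all add: algebra_simps)

lemma cont_log_gain: "continuous_on S (log_gain n)"
proof -
  have "continuous_on S (\<lambda>x. cmod (orbit_gain r \<epsilon> n x))"
    unfolding orbit_gain_def step_gain_def step_diag_def step_off_def by (intro cont) auto
  moreover have "cmod (orbit_gain r \<epsilon> n x) \<noteq> 0" for x using orbit_gain_bounds(2)[of n x] by linarith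
  ultimately show ?thesis unfolding log_gain_def[abs_def] by (intro continuous_on_ln) auto
qed

lemma log_gain_bound: "\<bar>log_gain n x\<bar> \<le> 1"
proof -
  let ?c = "cmod (orbit_gain r \<epsilon> n x)"
  have c: "17/20 \<le> ?c" "?c \<le> 23/20"
    using orbit_gain_bounds[of n x] norm_triangle_ineq[of "orbit_gain r \<epsilon> n x - 1" 1] by auto
  have c0: "0 < ?c" using c by linarith
  then have "ln ?c \<le> ?c - 1" by (rule ln_le_minus_one)
  moreover have "- ln ?c \<le> inverse ?c - 1"
    using ln_le_minus_one[of "inverse ?c"] c0 by (simp only: positive_imp_inverse_positive ln_inverse)
  moreover have "inverse ?c \<le> inverse (17/20)" using c by (intro le_imp_inverse_le) auto
  ultimately have "ln ?c \<le> 1" "- ln ?c \<le> 1" using c by simp_all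
  then show ?thesis unfolding log_gain_def by (rule abs_leI)
qed

text \<open>In the averaged expansion, \<open>\<rho> * z\<close> is evaluated through the
  correlation series and \<open>\<rho>\<^sup>2\<close> decouples into the lag-0 correlation.
  \<open>c1\<close> and \<open>c2\<close> collect what multiplies the means of \<open>z\<close> and
  \<open>z\<^sup>2\<close>. The errors add up as \<open>330 + 100 + 3 + 3 = 436\<close>.\<close>

lemma mean_log_gain:
  assumes n: "2 * m \<le> n"
  defines "c1 \<equiv> corr_sum/2 - 1/2 + doubling_corr r 0/4" and "c2 \<equiv> corr_sum/4 + doubling_corr r 0/8"
  shows "\<bar>integral {0..1} (log_gain n) - \<epsilon>^2 * ((doubling_corr r 0 + 2 * corr_sum)/8
      + Re (of_real c1 * integral {0..1} (z n) + of_real c2 * integral {0..1} (\<lambda>x. (z n x)\<^sup>2)))\<bar>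
     \<le> 436 * (R^3 * real m^2 * \<epsilon>^3)"
proof -
  let ?u = "R^3 * real m^2 * \<epsilon>^3"
  let ?r0 = "doubling_corr r 0" and ?e = "\<epsilon>^2"
  let ?Z1 = "integral {0..1} (z n)" and ?Z2 = "integral {0..1} (\<lambda>x. (z n x)\<^sup>2)"
  let ?X = "integral {0..1} (\<lambda>x. \<rho> n x *\<^sub>R z n x)"
  let ?Y1 = "integral {0..1} (\<lambda>x. (\<rho> n x)\<^sup>2 *\<^sub>R z n x)"
  let ?Y2 = "integral {0..1} (\<lambda>x. (\<rho> n x)\<^sup>2 *\<^sub>R (z n x)\<^sup>2)"
  have u0: "0 \<le> ?u" using R_ge_1 eps_pos by simp
  have cg: "continuous_on UNIV (\<lambda>x. (r x)\<^sup>2)" by (intro continuous_intros cont_r)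
  have pg: "(r (x + 1))\<^sup>2 = (r x)\<^sup>2" for x using r_periodic by simp
  have bg: "\<bar>(r x)\<^sup>2\<bar> \<le> R\<^sup>2" for x
    using r_bound[of x] R_ge_1 by (simp add: abs_le_square_iff[symmetric])
  have r0: "integral {0..1} (\<lambda>x. (r x)\<^sup>2) = ?r0" by (simp add: doubling_corr_def power2_eq_square)
  have r0n: "integral {0..1} (\<lambda>x. (\<rho> n x)\<^sup>2) = ?r0"
    using integral_doubling_invariant[OF cg pg, of n] r0 by simp
  \<comment> \<open>\<open>H\<close> is a complex integrand whose real part is the expansion, with
    \<open>Im z\<close> written as the real part of \<open>- \<i> * z\<close>; its mean can be
    computed linearly before taking real parts.\<close>
  define H where "H = (\<lambda>x. - \<i> * of_real (\<epsilon>/2) * (\<rho> n x *\<^sub>R z n x) + (of_real (?e/8) * of_real ((\<rho> n x)\<^sup>2)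
     + (of_real (?e/4) * ((\<rho> n x)\<^sup>2 *\<^sub>R z n x) - of_real (?e/2) * z n x
     + of_real (?e/8) * ((\<rho> n x)\<^sup>2 *\<^sub>R (z n x)\<^sup>2))))"
  have cH: "continuous_on S H" for S unfolding H_def by (intro cont)
  have ReH: "Re (H x) = \<epsilon>/2 * \<rho> n x * Im (z n x) + \<epsilon>\<^sup>2 * ((\<rho> n x)\<^sup>2/8 +
     Re (of_real ((\<rho> n x)\<^sup>2/4 - 1/2) * z n x + of_real ((\<rho> n x)\<^sup>2/8) * (z n x)\<^sup>2))" for x
    unfolding H_def scaleR_conv_of_real by (simp add: algebra_simps)
  have iH: "integral {0..1} H = - \<i> * of_real (\<epsilon>/2) * ?X + (of_real (?e/8) * of_real ?r0
     + (of_real (?e/4) * ?Y1 - of_real (?e/2) * ?Z1 + of_real (?e/8) * ?Y2))"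
  proof -
    have "((\<lambda>x. complex_of_real ((\<rho> n x)\<^sup>2)) has_integral of_real ?r0) {0..1}"
      unfolding r0n[symmetric] by (intro has_integral_of_real mean_has_integral cont)
    then show ?thesis unfolding H_def
      by (intro integral_unique has_integral_add has_integral_diff has_integral_mult_right mean_has_integral cont)
  qed
  have "Re (integral {0..1} H) = integral {0..1} (\<lambda>x. Re (H x))"
    using integral_linear[OF integrable_continuous_real[OF cH] bounded_linear_Re, of 0 1] by (simp add: o_def)
  moreover have "\<bar>integral {0..1} (log_gain n) - integral {0..1} (\<lambda>x. Re (H x))\<bar> \<le> 330 * R^3 * \<epsilon>^3"
  proof -
    have "norm (log_gain n x - Re (H x)) \<le> 330 * R^3 * \<epsilon>^3" for x
      using ln_step_gain_expansion[OF eps_pos eps_R R_ge_1 r_bound z_in_disk, of "2^n * x" n x]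
      unfolding ReH log_gain_def orbit_gain_def real_norm_def .
    from norm_mean_diff_le[OF cont_log_gain continuous_on_Re[OF cH] this]
    show ?thesis by (simp only: real_norm_def)
  qed
  moreover have "330 * R^3 * \<epsilon>^3 \<le> 330 * ?u" using monomial_mono[of 3 3 0 2 3 3] by simp
  ultimately have 1: "\<bar>integral {0..1} (log_gain n) - Re (integral {0..1} H)\<bar> \<le> 330 * ?u" by simp
  let ?V = "\<i> * of_real (\<epsilon>/2 * corr_sum) * integral {0..1} (\<lambda>x. (1 + z n x)\<^sup>2)"
  have iW: "integral {0..1} (\<lambda>x. (1 + z n x)\<^sup>2) = 1 + (2 * ?Z1 + ?Z2)"
  proof -
    have "((\<lambda>x. 1 + (2 * z n x + (z n x)\<^sup>2)) has_integral integral {0..1} (\<lambda>x::real. 1::complex) + (2 * ?Z1 + ?Z2)) {0..1}"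
      by (intro has_integral_add has_integral_mult_right mean_has_integral cont)
    then show ?thesis by (intro integral_unique) (simp add: power2_eq_square algebra_simps)
  qed
  have 2: "cmod (of_real (\<epsilon>/2) * (?X - ?V)) \<le> 100 * ?u"
  proof -
    have "cmod (of_real (\<epsilon>/2) * (?X - ?V)) = \<epsilon>/2 * cmod (?X - ?V)"
      using eps_pos by (simp only: norm_mult norm_of_real)
    also have "\<dots> \<le> \<epsilon>/2 * (200 * (R^3 * real m^2 * \<epsilon>^2))"
      using mean_drive_orbit[OF n] eps_pos by (intro mult_left_mono) auto
    finally show ?thesis by (simp add: power2_eq_square power3_eq_cube mult_ac)
  qed
  have mn: "m \<le> n" using n by simp
  have "cmod (?Y1 - of_real ?r0 * ?Z1) \<le> 11 * (R\<^sup>2) * 1 * (R * real m * \<epsilon>)"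
    using mean_decouple[OF cg pg bg, of "\<lambda>w. w" 1 n] mn unfolding r0 by (simp add: scaleR_conv_of_real)
  then have "?e/4 * cmod (?Y1 - of_real ?r0 * ?Z1) \<le> ?e/4 * (11 * (R\<^sup>2) * 1 * (R * real m * \<epsilon>))"
    by (intro mult_left_mono) auto
  also have "\<dots> = 11/4 * (R^3 * real m^1 * \<epsilon>^3)" by (simp add: power2_eq_square power3_eq_cube)
  also have "\<dots> \<le> 3 * ?u" using u0 monomial_mono[of 3 3 1 2 3 3] by linarith
  finally have 3: "cmod (of_real (?e/4) * (?Y1 - of_real ?r0 * ?Z1)) \<le> 3 * ?u"
    by (simp only: norm_mult norm_of_real) simp
  have "cmod (?Y2 - of_real ?r0 * ?Z2) \<le> 11 * (R\<^sup>2) * 2 * (R * real m * \<epsilon>)"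
    using mean_decouple[OF cg pg bg, of "\<lambda>w. w\<^sup>2" 2 n] mn square_lipschitz unfolding r0
    by (simp add: scaleR_conv_of_real continuous_on_power)
  then have "?e/8 * cmod (?Y2 - of_real ?r0 * ?Z2) \<le> ?e/8 * (11 * (R\<^sup>2) * 2 * (R * real m * \<epsilon>))"
    by (intro mult_left_mono) auto
  also have "\<dots> = 11/4 * (R^3 * real m^1 * \<epsilon>^3)" by (simp add: power2_eq_square power3_eq_cube)
  also have "\<dots> \<le> 3 * ?u" using u0 monomial_mono[of 3 3 1 2 3 3] by linarith
  finally have 4: "cmod (of_real (?e/8) * (?Y2 - of_real ?r0 * ?Z2)) \<le> 3 * ?u"
    by (simp only: norm_mult norm_of_real) simp
  let ?T = "of_real ?e * (of_real ((?r0 + 2 * corr_sum)/8) + (of_real c1 * ?Z1 + of_real c2 * ?Z2))"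
  \<comment> \<open>The difference from the main term splits exactly into the three errors already
    bounded.\<close>
  have alg: "- \<i> * (e/2) * X + (e\<^sup>2/8 * q + (e\<^sup>2/4 * Y1 - e\<^sup>2/2 * Z1 + e\<^sup>2/8 * Y2))
      - e\<^sup>2 * ((q + 2 * s)/8 + ((s/2 - 1/2 + q/4) * Z1 + (s/4 + q/8) * Z2))
     = - \<i> * (e/2 * (X - \<i> * (e/2 * s) * (1 + (2 * Z1 + Z2))))
      + (e\<^sup>2/4 * (Y1 - q * Z1) + e\<^sup>2/8 * (Y2 - q * Z2))"
    for e q s X Y1 Y2 Z1 Z2 :: complex
    by (simp add: power2_eq_square algebra_simps add_divide_distrib diff_divide_distrib)
  have "integral {0..1} H - ?T = - \<i> * (of_real (\<epsilon>/2) * (?X - ?V))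
     + (of_real (?e/4) * (?Y1 - of_real ?r0 * ?Z1) + of_real (?e/8) * (?Y2 - of_real ?r0 * ?Z2))"
    unfolding iH iW c1_def c2_def
    using alg[of "of_real \<epsilon>" ?X "of_real ?r0" ?Y1 ?Z1 ?Y2 "of_real corr_sum" ?Z2]
    by (simp only: of_real_add of_real_diff of_real_mult of_real_divide of_real_power of_real_numeral of_real_1)
  moreover have "cmod (a + (b + c)) \<le> cmod a + (cmod b + cmod c)" for a b c :: complex
    by (intro order_trans[OF norm_triangle_ineq] add_left_mono norm_triangle_ineq)
  ultimately have "cmod (integral {0..1} H - ?T) \<le> cmod (- \<i> * (of_real (\<epsilon>/2) * (?X - ?V)))
     + (cmod (of_real (?e/4) * (?Y1 - of_real ?r0 * ?Z1)) + cmod (of_real (?e/8) * (?Y2 - of_real ?r0 * ?Z2)))"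
    by (simp only:)
  also have "cmod (- \<i> * (of_real (\<epsilon>/2) * (?X - ?V))) = cmod (of_real (\<epsilon>/2) * (?X - ?V))"
    by (simp only: norm_mult norm_minus_cancel norm_ii mult_1_left)
  finally have "cmod (integral {0..1} H - ?T) \<le> 106 * ?u" using 2 3 4 by linarith
  then have "\<bar>Re (integral {0..1} H) - Re ?T\<bar> \<le> 106 * ?u"
    using abs_Re_le_cmod[of "integral {0..1} H - ?T"] by simp
  moreover have Re_eq: "Re (of_real b * (of_real c + w)) = b * (c + Re w)" for b c w by simp
  have "Re ?T = ?e * ((?r0 + 2 * corr_sum)/8 + Re (of_real c1 * ?Z1 + of_real c2 * ?Z2))"
    by (rule Re_eq)
  ultimately show ?thesis using 1 by linarith
qed

text \<open>The predicted growth of \<open>ln \<bar>\<alpha>\<bar>\<close> per step; it becomes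
  \<open>c_coeff a * E\<close> once \<open>\<epsilon>^2 = E / \<kappa>\<close>.\<close>

definition gain_rate :: real where
  "gain_rate = \<epsilon>^2 * ((doubling_corr r 0 + 2 * corr_sum) / 8)"

text \<open>The first \<open>2 * m\<close> steps, too early for the estimate of the mean gain,
  contribute at most 1 each. Afterwards the means of \<open>z\<close> and \<open>z\<^sup>2\<close>
  nearly rotate, so their sums are controlled by telescoping.\<close>

lemma mean_total_log_gain:
  "\<bar>integral {0..1} (\<lambda>x. \<Sum>n<2 * m + N. log_gain n x) - real N * gain_rate\<bar>
     \<le> real N * (520 * (R^4 * real m^2 * \<epsilon>^3)) + (2 * real m + 3 * R^2 * \<epsilon>)"
proof -
  define c1 where "c1 = corr_sum/2 - 1/2 + doubling_corr r 0/4"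
  define c2 where "c2 = corr_sum/4 + doubling_corr r 0/8"
  let ?K = "2 * m"
  let ?Z1 = "\<lambda>i. integral {0..1} (z (?K + i))" and ?Z2 = "\<lambda>i. integral {0..1} (\<lambda>x. (z (?K + i) x)\<^sup>2)"
  let ?u = "R^3 * real m^2 * \<epsilon>^3" and ?v = "R^4 * real m^2 * \<epsilon>^3"
  have R2: "1 \<le> R^2" using R_ge_1 by simp
  have c1: "\<bar>c1\<bar> \<le> 2 * R^2"
    unfolding c1_def using corr_sum_bound doubling_corr_bound'[of 0] R2 by (simp only: abs_le_iff) linarith
  have c2: "\<bar>c2\<bar> \<le> R^2"
    unfolding c2_def using corr_sum_bound doubling_corr_bound'[of 0] R2 by (simp only: abs_le_iff) linarith
  have sum_split: "(\<Sum>n<K + N. f n) = (\<Sum>n<K. f n) + (\<Sum>i<N. f (K + i))" for K N and f :: "nat \<Rightarrow> real"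
    by (induction N) auto
  have "integral {0..1} (\<lambda>x. \<Sum>n<?K + N. log_gain n x) = (\<Sum>n<?K + N. integral {0..1} (log_gain n))"
    by (intro integral_unique has_integral_sum mean_has_integral cont_log_gain finite_lessThan)
  also have "\<dots> = (\<Sum>n<?K. integral {0..1} (log_gain n)) + (\<Sum>i<N. integral {0..1} (log_gain (?K + i)))"
    by (rule sum_split)
  finally have split: "integral {0..1} (\<lambda>x. \<Sum>n<?K + N. log_gain n x)
     = (\<Sum>n<?K. integral {0..1} (log_gain n)) + (\<Sum>i<N. integral {0..1} (log_gain (?K + i)))" .
  have "\<bar>\<Sum>n<?K. integral {0..1} (log_gain n)\<bar> \<le> (\<Sum>n<?K. 1)"
    by (rule order_trans[OF sum_abs sum_mono])
       (use norm_mean_le[OF cont_log_gain, of _ 1] log_gain_bound in auto)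
  then have 1: "\<bar>\<Sum>n<?K. integral {0..1} (log_gain n)\<bar> \<le> 2 * real m" by simp
  let ?g = "\<lambda>i. gain_rate + \<epsilon>^2 * Re (of_real c1 * ?Z1 i + of_real c2 * ?Z2 i)"
  have "\<bar>(\<Sum>i<N. integral {0..1} (log_gain (?K + i))) - (\<Sum>i<N. ?g i)\<bar> \<le> (\<Sum>i<N. 436 * ?u)"
    unfolding sum_subtractf[symmetric]
  proof (rule order_trans[OF sum_abs sum_mono])
    fix i
    show "\<bar>integral {0..1} (log_gain (?K + i)) - ?g i\<bar> \<le> 436 * ?u"
      using mean_log_gain[of "?K + i"] unfolding c1_def c2_def gain_rate_def distrib_left[of "\<epsilon>^2"] by simp
  qed
  then have 2: "\<bar>(\<Sum>i<N. integral {0..1} (log_gain (?K + i))) - (\<Sum>i<N. ?g i)\<bar> \<le> real N * (436 * ?u)" by simp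
  have "(\<Sum>i<N. ?g i) - real N * gain_rate = \<epsilon>^2 * Re (of_real c1 * (\<Sum>i<N. ?Z1 i) + of_real c2 * (\<Sum>i<N. ?Z2 i))"
  proof -
    have "(\<Sum>i<N. ?g i) = real N * gain_rate + \<epsilon>^2 * (\<Sum>i<N. Re (of_real c1 * ?Z1 i + of_real c2 * ?Z2 i))"
      unfolding sum.distrib sum_distrib_left by simp
    moreover have "(\<Sum>i<N. Re (of_real c1 * ?Z1 i + of_real c2 * ?Z2 i))
        = Re (of_real c1 * (\<Sum>i<N. ?Z1 i) + of_real c2 * (\<Sum>i<N. ?Z2 i))"
      unfolding Re_sum[symmetric] sum.distrib sum_distrib_left ..
    ultimately show ?thesis by (simp only: add_diff_cancel_left')
  qed
  then have "\<bar>(\<Sum>i<N. ?g i) - real N * gain_rate\<bar> = \<epsilon>^2 * \<bar>Re (of_real c1 * (\<Sum>i<N. ?Z1 i) + of_real c2 * (\<Sum>i<N. ?Z2 i))\<bar>"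
    by (simp add: abs_mult)
  also have "\<dots> \<le> \<epsilon>^2 * (\<bar>c1\<bar> * cmod (\<Sum>i<N. ?Z1 i) + \<bar>c2\<bar> * cmod (\<Sum>i<N. ?Z2 i))"
    by (intro mult_left_mono order_trans[OF abs_Re_le_cmod] order_trans[OF norm_triangle_ineq])
       (simp_all add: norm_mult)
  also have "\<dots> \<le> \<epsilon>^2 * (2 * R^2 * ((2 + real N * (42 * (R^2 * real m * \<epsilon>^2))) / (2 * \<epsilon>))
      + R^2 * ((2 + real N * (153 * (R^2 * real m * \<epsilon>^2))) / (4 * \<epsilon>)))"
  proof (intro mult_left_mono add_mono mult_mono c1 c2)
    have "cmod (\<Sum>i<N. ?Z1 i) \<le> (2 + real N * (42 * (R^2 * real m * \<epsilon>^2))) / cmod (\<i> * of_real (2 * \<epsilon>))"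
    proof (rule sum_near_rotation_bound)
      show "cmod (?Z1 i) \<le> 1" for i by (rule norm_mean_le[OF cont_z z_in_disk])
      show "cmod (?Z1 (Suc i) - ?Z1 i + \<i> * of_real (2 * \<epsilon>) * ?Z1 i) \<le> 42 * (R^2 * real m * \<epsilon>^2)" for i
        using mean_z_step[of "?K + i"] by simp
    qed (use eps_pos in simp)
    then show "cmod (\<Sum>i<N. ?Z1 i) \<le> (2 + real N * (42 * (R^2 * real m * \<epsilon>^2))) / (2 * \<epsilon>)"
      using eps_pos by (simp add: norm_mult)
    have "cmod (\<Sum>i<N. ?Z2 i) \<le> (2 + real N * (153 * (R^2 * real m * \<epsilon>^2))) / cmod (\<i> * of_real (4 * \<epsilon>))"
    proof (rule sum_near_rotation_bound)
      show "cmod (?Z2 i) \<le> 1" for i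
        by (rule norm_mean_le) (auto intro!: cont simp: norm_power power_le_one z_in_disk)
      show "cmod (?Z2 (Suc i) - ?Z2 i + \<i> * of_real (4 * \<epsilon>) * ?Z2 i) \<le> 153 * (R^2 * real m * \<epsilon>^2)" for i
        using mean_z_square_step[of "?K + i"] by (simp only: add_Suc_right)
    qed (use eps_pos in simp)
    then show "cmod (\<Sum>i<N. ?Z2 i) \<le> (2 + real N * (153 * (R^2 * real m * \<epsilon>^2))) / (4 * \<epsilon>)"
      using eps_pos by (simp add: norm_mult)
  qed auto
  \<comment> \<open>Dividing by the rotation speeds \<open>2 * \<epsilon>\<close> and
    \<open>4 * \<epsilon>\<close> costs one power of \<open>\<epsilon>\<close>, and the prefactor
    gives two: errors of order \<open>\<epsilon>^2\<close> per step end up at order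
    \<open>\<epsilon>^3\<close>.\<close>
  also have "\<dots> = real N * (42 * (R^4 * real m^1 * \<epsilon>^3) + 153/4 * (R^4 * real m^1 * \<epsilon>^3)) + 5/2 * R^2 * \<epsilon>"
  proof -
    have "\<epsilon>^2 * (2 * S * ((2 + n * (42 * v)) / (2 * \<epsilon>)) + S * ((2 + n * (153 * v)) / (4 * \<epsilon>)))
        = n * (42 * (S * v * \<epsilon>) + 153/4 * (S * v * \<epsilon>)) + 5/2 * S * \<epsilon>" for S n v
      using eps_pos by (simp add: field_simps power2_eq_square)
    moreover have "R^2 * (R^2 * real m * \<epsilon>^2) * \<epsilon> = R^4 * real m^1 * \<epsilon>^3"
      by (simp add: eval_nat_numeral)
    ultimately show ?thesis by (simp only:)
  qed
  also have "\<dots> \<le> real N * (84 * ?v) + 3 * R^2 * \<epsilon>"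
  proof (intro add_mono mult_left_mono)
    have "0 \<le> R^4 * real m^2 * \<epsilon>^3" using eps_pos by simp
    then show "42 * (R^4 * real m^1 * \<epsilon>^3) + 153/4 * (R^4 * real m^1 * \<epsilon>^3) \<le> 84 * ?v"
      using monomial_mono[of 4 4 1 2 3 3] by linarith
    show "5/2 * R^2 * \<epsilon> \<le> 3 * R^2 * \<epsilon>" using eps_pos by simp
  qed simp
  finally have 3: "\<bar>(\<Sum>i<N. ?g i) - real N * gain_rate\<bar> \<le> real N * (84 * ?v) + 3 * R^2 * \<epsilon>" .
  have "?u \<le> ?v" by (intro monomial_mono) auto
  then have "real N * (436 * ?u) \<le> real N * (436 * ?v)" by (intro mult_left_mono) auto
  moreover have "real N * (520 * ?v) = real N * (436 * ?v) + real N * (84 * ?v)" by (simp add: algebra_simps)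
  ultimately show ?thesis unfolding split using 1 2 3 by linarith
qed

end

section \<open>Transfer matrices\<close>

context small_doubling_cocycle
begin

text \<open>The coefficient \<open>\<alpha>\<close> of the product of the first \<open>n\<close>
  steps.\<close>

definition orbit_product :: "nat \<Rightarrow> real \<Rightarrow> complex" where
  "orbit_product n x = (\<Prod>j<n. orbit_gain r \<epsilon> j x)"

lemma orbit_gain_nonzero: "orbit_gain r \<epsilon> n x \<noteq> 0"
  using orbit_gain_bounds(2)[of n x] by auto

lemma ln_orbit_product: "ln (cmod (orbit_product n x)) = (\<Sum>j<n. log_gain j x)"
proof -
  have "ln (\<Prod>j<n. cmod (orbit_gain r \<epsilon> j x)) = (\<Sum>j<n. log_gain j x)"
    unfolding log_gain_def using orbit_gain_nonzero by (intro ln_prod) auto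
  then show ?thesis by (simp only: orbit_product_def prod_norm)
qed

text \<open>With \<open>z = cnj \<beta> / \<alpha>\<close>, the conserved quantity is the
  determinant \<open>\<bar>\<alpha>\<bar>^2 - \<bar>\<beta>\<bar>^2 = 1\<close>.\<close>

lemma orbit_product_ge_1: "1 \<le> cmod (orbit_product n x)"
proof -
  have "(cmod (orbit_product n x))\<^sup>2 * (1 - (cmod (z n x))\<^sup>2) = 1"
  proof (induction n)
    case (Suc n)
    let ?D = "orbit_gain r \<epsilon> n x" and ?N = "cnj (step_diag \<epsilon> (\<rho> n x)) * z n x + cnj (step_off \<epsilon> (\<rho> n x))"
    have D: "cmod ?D \<noteq> 0" using orbit_gain_nonzero by simp
    have "cmod (z (Suc n) x) = cmod ?N / cmod ?D"
      by (simp add: step_moebius_def orbit_gain_def norm_divide)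
    then have "(cmod ?D)\<^sup>2 * (1 - (cmod (z (Suc n) x))\<^sup>2) = (cmod ?D)\<^sup>2 - (cmod ?N)\<^sup>2"
      using D by (simp add: power_divide right_diff_distrib)
    also have "\<dots> = 1 - (cmod (z n x))\<^sup>2"
      unfolding orbit_gain_def by (rule step_norm_identity)
    finally have s: "(cmod ?D)\<^sup>2 * (1 - (cmod (z (Suc n) x))\<^sup>2) = 1 - (cmod (z n x))\<^sup>2" .
    have "(cmod (orbit_product (Suc n) x))\<^sup>2 * (1 - (cmod (z (Suc n) x))\<^sup>2)
        = (cmod (orbit_product n x))\<^sup>2 * ((cmod ?D)\<^sup>2 * (1 - (cmod (z (Suc n) x))\<^sup>2))"
      by (simp only: orbit_product_def prod.lessThan_Suc norm_mult power_mult_distrib mult.assoc)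
    then show ?case unfolding s Suc .
  qed (simp add: orbit_product_def)
  moreover have "(cmod (orbit_product n x))\<^sup>2 * (1 - (cmod (z n x))\<^sup>2) \<le> (cmod (orbit_product n x))\<^sup>2 * 1"
    by (intro mult_left_mono) auto
  ultimately have "1\<^sup>2 \<le> (cmod (orbit_product n x))\<^sup>2" by simp
  then show ?thesis by (rule power2_le_imp_le) simp
qed

text \<open>The total logarithmic gain is never negative; a rate below minus the error per step
  would make its mean negative for large \<open>N\<close>.\<close>

lemma gain_rate_lower: "- (520 * (R^4 * real m^2 * \<epsilon>^3)) \<le> gain_rate"
proof (rule ccontr)
  assume "\<not> - (520 * (R^4 * real m^2 * \<epsilon>^3)) \<le> gain_rate"
  then have d: "0 < - gain_rate - 520 * (R^4 * real m^2 * \<epsilon>^3)" (is "0 < ?d") by simp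
  let ?C = "2 * real m + 3 * R^2 * \<epsilon>"
  obtain N where N: "?C < real N * ?d" using reals_Archimedean3[OF d] by blast
  have "0 \<le> integral {0..1} (\<lambda>x. \<Sum>n<2 * m + N. log_gain n x)"
  proof (rule integral_nonneg)
    show "0 \<le> (\<Sum>n<2 * m + N. log_gain n x)" for x
      unfolding ln_orbit_product[symmetric] using orbit_product_ge_1 by (rule ln_ge_zero)
  qed (intro integrable_continuous_real continuous_intros cont_log_gain)
  then have "0 \<le> real N * gain_rate + real N * (520 * (R^4 * real m^2 * \<epsilon>^3)) + ?C"
    using mean_total_log_gain[of N] by linarith
  then show False using N by (simp add: algebra_simps)
qed

end

text \<open>The upper bound lets \<open>N\<close> grow in the estimate. For the lower bound,
  subadditivity bounds \<open>l n / n\<close> from below by values at large multiples of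
  \<open>n\<close>, where the estimate applies.\<close>

lemma subadditive_inf_estimate:
  fixes l :: "nat \<Rightarrow> real"
  assumes sub: "\<And>m n. l (m + n) \<le> l m + l n"
    and est: "\<And>N. \<bar>l (K + N) - real N * g\<bar> \<le> real N * e + C"
  shows "\<bar>(INF n\<in>{0<..}. (1 / real n) * l n) - g\<bar> \<le> e"
proof -
  let ?L = "INF n\<in>{0<..}. (1 / real n) * l n"
  have mult: "l (Suc k * n) \<le> real (Suc k) * l n" for k n
  proof (induction k)
    case (Suc k)
    have "l (Suc (Suc k) * n) \<le> l n + l (Suc k * n)" using sub[of n "Suc k * n"] by simp
    then show ?case using Suc by (simp add: algebra_simps)
  qed simp
  have low: "g - e \<le> (1 / real n) * l n" if n: "0 < n" for n
  proof (rule ccontr)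
    assume "\<not> ?thesis"
    then have d: "0 < real n * (g - e) - l n" (is "0 < ?d") using n by (simp add: field_simps)
    obtain N where N: "real K * (g - e) + C < real N * ?d" using reals_Archimedean3[OF d] by blast
    \<comment> \<open>The multiple \<open>Suc k * n\<close> is then at least \<open>K\<close>, so
      the estimate covers it, and \<open>Suc k\<close> exceeds \<open>N\<close>, so the defect
      \<open>?d\<close> accumulates enough.\<close>
    define k where "k = K + N"
    obtain j where j: "Suc k * n = K + j"
    proof -
      have "K \<le> Suc k * n" using n unfolding k_def by (cases n) auto
      then show ?thesis using that le_Suc_ex by metis
    qed
    have "real j * (g - e) - C \<le> l (Suc k * n)" unfolding j using est[of j] by (simp add: algebra_simps abs_le_iff)
    also have "\<dots> \<le> real (Suc k) * l n" by (rule mult)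
    finally have "(real (Suc k * n) - real K) * (g - e) - C \<le> real (Suc k) * l n" unfolding j by simp
    then have "real (Suc k) * ?d \<le> real K * (g - e) + C" by (simp add: algebra_simps)
    moreover have "real N * ?d \<le> real (Suc k) * ?d" using d by (intro mult_right_mono) (auto simp: k_def)
    ultimately show False using N by linarith
  qed
  have bdd: "bdd_below ((\<lambda>n. (1 / real n) * l n) ` {0<..})"
    using low by (intro bdd_belowI2[of _ "g - e"]) auto
  have "g - e \<le> ?L" by (rule cINF_greatest) (use low in auto)
  moreover have "?L \<le> g + e"
  proof (rule ccontr)
    assume "\<not> ?thesis"
    then have d: "0 < ?L - (g + e)" (is "0 < ?d") by simp
    obtain N where N: "C - real K * ?L < real N * ?d" using reals_Archimedean3[OF d] by blast
    \<comment> \<open>Using \<open>Suc N\<close> keeps the index positive even when \<open>K\<close>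
      and \<open>N\<close> are 0.\<close>
    have N': "C - real K * ?L < real (Suc N) * ?d" using N d by (simp add: algebra_simps)
    have "?L \<le> (1 / real (K + Suc N)) * l (K + Suc N)" by (rule cINF_lower[OF bdd]) auto
    then have "real (K + Suc N) * ?L \<le> l (K + Suc N)" by (simp add: field_simps)
    also have "\<dots> \<le> real (Suc N) * (g + e) + C" using est[of "Suc N"] by (simp add: algebra_simps abs_le_iff)
    finally show False using N' by (simp add: algebra_simps)
  qed
  ultimately show ?thesis by (simp add: abs_le_iff)
qed

section \<open>Continuity of operator norms and the cocycle identity\<close>

lemma circle_mean_eq_integral:
  assumes "continuous_on {0..1} f"
  shows "circle_mean f = integral {0..1} f"
  unfolding circle_mean_def by (intro set_borel_integral_eq_integral borel_integrable_atLeastAtMost' assms)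

lemma onorm_matrix_diff:
  fixes A B :: "real^'n^'m"
  shows "\<bar>onorm ((*v) A) - onorm ((*v) B)\<bar> \<le> (\<Sum>i\<in>UNIV. \<Sum>j\<in>UNIV. \<bar>A $ i $ j - B $ i $ j\<bar>)"
proof -
  have t: "onorm ((*v) (A + B)) \<le> onorm ((*v) A) + onorm ((*v) B)" for A B :: "real^'n^'m"
    unfolding matrix_vector_mult_add_rdistrib[abs_def] by (intro onorm_triangle matrix_vector_mul_bounded_linear)
  have "onorm ((*v) A) \<le> onorm ((*v) B) + onorm ((*v) (A - B))" using t[of B "A - B"] by simp
  moreover have "onorm ((*v) B) \<le> onorm ((*v) A) + onorm ((*v) (B - A))" using t[of A "B - A"] by simp
  moreover have "onorm ((*v) (A - B)) \<le> (\<Sum>i\<in>UNIV. \<Sum>j\<in>UNIV. \<bar>A $ i $ j - B $ i $ j\<bar>)"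
    using onorm_le_matrix_component_sum[of "A - B"] by simp
  moreover have "onorm ((*v) (B - A)) \<le> (\<Sum>i\<in>UNIV. \<Sum>j\<in>UNIV. \<bar>A $ i $ j - B $ i $ j\<bar>)"
    using onorm_le_matrix_component_sum[of "B - A"] by (simp add: abs_minus_commute)
  ultimately show ?thesis by linarith
qed

lemma continuous_on_onorm_matrix:
  fixes T :: "'a::topological_space \<Rightarrow> real^'n^'m"
  assumes "\<And>i j. continuous_on S (\<lambda>x. T x $ i $ j)"
  shows "continuous_on S (\<lambda>x. onorm ((*v) (T x)))"
  unfolding continuous_on_def
proof
  fix x assume x: "x \<in> S"
  show "((\<lambda>y. onorm ((*v) (T y))) \<longlongrightarrow> onorm ((*v) (T x))) (at x within S)"
  proof (rule Lim_transform[OF tendsto_const], rule Lim_null_comparison)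
    show "\<forall>\<^sub>F y in at x within S. norm (onorm ((*v) (T y)) - onorm ((*v) (T x))) \<le> (\<Sum>i\<in>UNIV. \<Sum>j\<in>UNIV. \<bar>T y $ i $ j - T x $ i $ j\<bar>)"
      using onorm_matrix_diff by (intro always_eventually) auto
    have "((\<lambda>y. \<Sum>i\<in>UNIV. \<Sum>j\<in>UNIV. \<bar>T y $ i $ j - T x $ i $ j\<bar>) \<longlongrightarrow> (\<Sum>i\<in>(UNIV::'m set). \<Sum>j\<in>(UNIV::'n set). \<bar>T x $ i $ j - T x $ i $ j\<bar>)) (at x within S)"
    proof (intro tendsto_sum tendsto_rabs tendsto_diff tendsto_const)
      show "((\<lambda>y. T y $ i $ j) \<longlongrightarrow> T x $ i $ j) (at x within S)" for i j
        using assms x unfolding continuous_on_def by blast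
    qed
    then show "((\<lambda>y. \<Sum>i\<in>UNIV. \<Sum>j\<in>UNIV. \<bar>T y $ i $ j - T x $ i $ j\<bar>) \<longlongrightarrow> 0) (at x within S)" by simp
  qed
qed

lemma sample_shift: "sample a j (2^m * x) = sample a (m + j) x"
  by (simp add: sample_def power_add mult_ac)

text \<open>The cocycle identity over the doubling map: the last \<open>n\<close> steps are those of
  the point \<open>2^m * x\<close>.\<close>

lemma transfer_matrix_add:
  "transfer_matrix a E (m + n) x = transfer_matrix a E n (2^m * x) ** transfer_matrix a E m x"
proof (induction n)
  case (Suc n)
  have "cocycle_step a E n (2^m * x) = cocycle_step a E (m + n) x"
    by (simp add: cocycle_step_def sample_shift)
  then show ?case using Suc by (simp add: matrix_mul_assoc)
qed simp

text \<open>The intended choice is \<open>lam = \<epsilon> * \<kappa>\<close>. Then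
  \<open>a_r\<close> says \<open>\<kappa> / a = 1 - r\<close>, and the energy is
  \<open>\<epsilon>^2 * \<kappa>\<close>.\<close>

locale div_grad_cocycle = small_doubling_cocycle +
  fixes a :: "real \<Rightarrow> real" and E lam hi :: real
  assumes a_periodic: "a (x + 1) = a x"
    and a_cont: "continuous_on UNIV a"
    and a_pos: "0 < a x"
    and a_le: "a x \<le> hi"
    and lam_pos: "0 < lam"
    and a_r: "lam / a x = \<epsilon> * (1 - r x)"
    and E_def: "E = \<epsilon> * lam"
begin

section \<open>Flux coordinates for the transfer matrices\<close>

lemma sample_eq: "sample a j x = a (2^j * x)"
proof -
  have "a (frac y) = a y" for y by (rule periodic_frac[of a, OF a_periodic])
  then show ?thesis by (simp add: sample_def)
qed

lemma hi_pos: "0 < hi" using a_pos[of 0] a_le[of 0] by linarith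

text \<open>Real and imaginary part are the rescaled flux \<open>a\<^sub>j (\<psi>\<^sub>j - \<psi>\<^sub>j\<^sub>-\<^sub>1) / lam\<close> and \<open>\<psi>\<^sub>j\<^sub>-\<^sub>1\<close>
  for \<open>w = (a\<^sub>j \<psi>\<^sub>j, \<psi>\<^sub>j\<^sub>-\<^sub>1)\<close>; in this coordinate the unperturbed step is nearly a rotation.\<close>

definition flux_coord :: "nat \<Rightarrow> real \<Rightarrow> real^2 \<Rightarrow> complex" where
  "flux_coord j x w = Complex ((w $ 1 - a (2^j * x) * w $ 2) / lam) (w $ 2)"

text \<open>In flux coordinates the difference equation becomes two shears: \<open>\<psi>\<close>
  grows by \<open>lam / a\<close> times the flux, then the flux drops by \<open>\<epsilon>\<close>
  times the new \<open>\<psi>\<close>. Here \<open>p\<close> is the flux before the step and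
  \<open>t\<close> the first shear coefficient.\<close>

lemma flux_coord_step:
  "flux_coord (Suc j) x (cocycle_step a E j x *v w)
     = step_diag \<epsilon> (\<rho> j x) * flux_coord j x w + step_off \<epsilon> (\<rho> j x) * cnj (flux_coord j x w)"
proof -
  define s where "s = a (2^j * x)"
  define s' where "s' = a (2^Suc j * x)"
  define t where "t = \<epsilon> * (1 - \<rho> j x)"
  have s: "s > 0" unfolding s_def by (rule a_pos)
  have t: "t = lam / s" unfolding t_def s_def by (rule a_r[symmetric])
  let ?v = "cocycle_step a E j x *v w"
  have smp: "sample a j x = s" "sample a (Suc j) x = s'" unfolding sample_eq s_def s'_def by simp_all
  have v1: "?v $ 1 = ((s' + s - E) * w $ 1 - s\<^sup>2 * w $ 2) / s"
    using s by (simp add: cocycle_step_def smp matrix_vector_mult_def sum_2 field_simps)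
  have v2: "?v $ 2 = w $ 1 / s"
    by (simp add: cocycle_step_def smp matrix_vector_mult_def sum_2)
  define p where "p = (w $ 1 - s * w $ 2) / lam"
  have v2': "?v $ 2 = w $ 2 + t * p"
    unfolding v2 p_def t using s lam_pos by (simp add: field_simps)
  have w1s: "w $ 1 / s = w $ 2 + t * p" using v2 v2' by simp
  have "?v $ 1 - s' * ?v $ 2 = w $ 1 - s * w $ 2 - E * (w $ 1 / s)"
    unfolding v1 v2 using s by (simp add: field_simps power2_eq_square)
  also have "\<dots> = w $ 1 - s * w $ 2 - \<epsilon> * lam * (w $ 2 + t * p)" by (simp only: w1s E_def)
  finally have v1_eq: "?v $ 1 - s' * ?v $ 2 = w $ 1 - s * w $ 2 - \<epsilon> * lam * (w $ 2 + t * p)" .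
  have "(A - \<epsilon> * lam * B) / lam = A / lam - \<epsilon> * B" for A B
    using lam_pos by (simp add: field_simps)
  then have v1': "(?v $ 1 - s' * ?v $ 2) / lam = p - \<epsilon> * (w $ 2 + t * p)"
    unfolding v1_eq p_def[symmetric] by (simp only: p_def[symmetric])
  have lhs: "flux_coord (Suc j) x ?v = Complex (p - \<epsilon> * (w $ 2 + t * p)) (w $ 2 + t * p)"
    unfolding flux_coord_def s'_def[symmetric] unfolding v1' unfolding v2' ..
  have zw: "flux_coord j x w = Complex p (w $ 2)" unfolding flux_coord_def p_def s_def ..
  have dA: "step_diag \<epsilon> (\<rho> j x) = Complex (1 - \<epsilon> * t / 2) ((\<epsilon> + t) / 2)"
    by (simp add: step_diag_def complex_eq_iff t_def power2_eq_square field_simps)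
  have dB: "step_off \<epsilon> (\<rho> j x) = Complex (- \<epsilon> * t / 2) ((t - \<epsilon>) / 2)"
    by (simp add: step_off_def complex_eq_iff t_def power2_eq_square field_simps)
  show ?thesis unfolding lhs zw dA dB by (simp add: complex_eq_iff field_simps)
qed

text \<open>The product has \<open>\<alpha> = orbit_product n x\<close> and
  \<open>cnj \<beta> = z n x * \<alpha>\<close>. Composition with one more step acts on the pair
  \<open>(\<alpha>, cnj \<beta>)\<close> by the gain and Moebius recursions.\<close>

lemma flux_coord_transfer:
  "flux_coord n x (transfer_matrix a E n x *v w)
     = orbit_product n x * flux_coord 0 x w + cnj (z n x * orbit_product n x) * cnj (flux_coord 0 x w)"
proof (induction n)
  case (Suc n)
  let ?A = "step_diag \<epsilon> (\<rho> n x)" and ?B = "step_off \<epsilon> (\<rho> n x)" and ?P = "orbit_product n x"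
  let ?c = "flux_coord 0 x w" and ?D = "orbit_gain r \<epsilon> n x"
  have P: "orbit_product (Suc n) x = ?P * (?A + ?B * z n x)"
    by (simp add: orbit_product_def orbit_gain_def step_gain_def)
  have zP: "z (Suc n) x * orbit_product (Suc n) x = (cnj ?A * z n x + cnj ?B) * ?P"
    using orbit_gain_nonzero[of n x]
    by (simp add: orbit_product_def step_moebius_def orbit_gain_def[symmetric])
  have "transfer_matrix a E (Suc n) x *v w = cocycle_step a E n x *v (transfer_matrix a E n x *v w)"
    by (simp add: matrix_vector_mul_assoc)
  then show ?case
    unfolding zP unfolding P by (simp only: flux_coord_step Suc) (simp add: algebra_simps)
qed (simp add: orbit_product_def)

text \<open>Bounds for the coordinate change and its inverse, uniform in \<open>j\<close> and
  \<open>x\<close>. They may blow up as \<open>E\<close> tends to 0, but enter only a constant that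
  disappears after division by \<open>n\<close>.\<close>

definition coord_bound where "coord_bound = (1 + hi) / lam + 1"
definition coord_inv_bound where "coord_inv_bound = lam + hi + 1"

lemma flux_coord_le: "cmod (flux_coord j x w) \<le> coord_bound * norm w"
proof -
  have c: "\<bar>w $ 1\<bar> \<le> norm w" "\<bar>w $ 2\<bar> \<le> norm w" using component_le_norm_cart by auto
  have "\<bar>a (2^j * x) * w $ 2\<bar> \<le> hi * norm w"
    unfolding abs_mult using a_pos[of "2^j * x"] a_le[of "2^j * x"] c by (intro mult_mono) auto
  then have "\<bar>w $ 1 - a (2^j * x) * w $ 2\<bar> \<le> (1 + hi) * norm w" using c by (simp add: algebra_simps abs_le_iff)
  then have "\<bar>(w $ 1 - a (2^j * x) * w $ 2) / lam\<bar> \<le> (1 + hi) * norm w / lam"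
    using lam_pos by (simp add: divide_right_mono)
  then show ?thesis
    using cmod_le[of "flux_coord j x w"] c unfolding flux_coord_def coord_bound_def by (simp add: algebra_simps)
qed

lemma norm_le_flux_coord: "norm w \<le> coord_inv_bound * cmod (flux_coord j x w)"
proof -
  let ?c = "flux_coord j x w"
  have w2: "w $ 2 = Im ?c" by (simp add: flux_coord_def)
  have w1: "w $ 1 = lam * Re ?c + a (2^j * x) * Im ?c" using lam_pos by (simp add: flux_coord_def)
  have "\<bar>a (2^j * x) * Im ?c\<bar> \<le> hi * cmod ?c"
    unfolding abs_mult using a_pos[of "2^j * x"] a_le[of "2^j * x"] abs_Im_le_cmod by (intro mult_mono) auto
  moreover have "\<bar>lam * Re ?c\<bar> \<le> lam * cmod ?c"
    unfolding abs_mult using lam_pos abs_Re_le_cmod by (intro mult_mono) auto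
  ultimately have "\<bar>w $ 1\<bar> + \<bar>w $ 2\<bar> \<le> coord_inv_bound * cmod ?c"
    unfolding w1 w2 coord_inv_bound_def using abs_Im_le_cmod[of ?c] by (simp add: algebra_simps)
  moreover have "norm w \<le> \<bar>w $ 1\<bar> + \<bar>w $ 2\<bar>"
    using norm_le_l1_cart[of w] by (simp add: sum_2)
  ultimately show ?thesis by linarith
qed

lemma coord_bounds_ge_1: "1 \<le> coord_bound" "1 \<le> coord_inv_bound"
  using hi_pos lam_pos by (auto simp: coord_bound_def coord_inv_bound_def)

lemma onorm_transfer_le:
  "onorm ((*v) (transfer_matrix a E n x)) \<le> 2 * coord_bound * coord_inv_bound * cmod (orbit_product n x)"
proof (rule onorm_le)
  fix w
  let ?P = "orbit_product n x" and ?c = "flux_coord 0 x w"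
  have "norm (transfer_matrix a E n x *v w) \<le> coord_inv_bound * cmod (flux_coord n x (transfer_matrix a E n x *v w))"
    by (rule norm_le_flux_coord)
  also have "cmod (flux_coord n x (transfer_matrix a E n x *v w)) \<le> cmod ?P * cmod ?c + cmod (z n x) * cmod ?P * cmod ?c"
    unfolding flux_coord_transfer by (rule order_trans[OF norm_triangle_ineq]) (simp add: norm_mult)
  also have "\<dots> \<le> cmod ?P * cmod ?c + 1 * cmod ?P * cmod ?c"
    by (intro add_left_mono mult_right_mono z_in_disk) auto
  also have "\<dots> = 2 * cmod ?P * cmod ?c" by simp
  also have "\<dots> \<le> 2 * cmod ?P * (coord_bound * norm w)" by (intro mult_left_mono flux_coord_le) auto
  finally show "norm (transfer_matrix a E n x *v w) \<le> 2 * coord_bound * coord_inv_bound * cmod ?P * norm w"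
    using coord_bounds_ge_1 by (simp add: mult_left_mono mult_ac)
qed

lemma onorm_transfer_ge:
  "cmod (orbit_product n x) \<le> 2 * coord_bound * coord_inv_bound * onorm ((*v) (transfer_matrix a E n x))"
proof -
  let ?P = "orbit_product n x" and ?T = "transfer_matrix a E n x"
  let ?o = "onorm ((*v) ?T)"
  \<comment> \<open>\<open>w1\<close> and \<open>w2\<close> have coordinates 1 and
    \<open>\<i>\<close>. For a map \<open>M\<close> with coefficients \<open>\<alpha>\<close> and
    \<open>\<beta>\<close>, \<open>M 1 - \<i> * M \<i> = 2 * \<alpha>\<close> isolates
    \<open>\<alpha>\<close>.\<close>
  define w1 :: "real^2" where "w1 = vector [lam, 0]"
  define w2 :: "real^2" where "w2 = vector [a x, 1]"
  have c1: "flux_coord 0 x w1 = 1" using lam_pos by (simp add: flux_coord_def w1_def complex_eq_iff)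
  have c2: "flux_coord 0 x w2 = \<i>" by (simp add: flux_coord_def w2_def complex_eq_iff)
  have o0: "0 \<le> ?o" by (intro onorm_pos_le matrix_vector_mul_bounded_linear)
  have b: "cmod (flux_coord n x (?T *v w)) \<le> coord_bound * (?o * coord_inv_bound)" if "cmod (flux_coord 0 x w) = 1" for w
  proof -
    have "norm (?T *v w) \<le> ?o * norm w" by (intro onorm matrix_vector_mul_bounded_linear)
    also have "norm w \<le> coord_inv_bound" using norm_le_flux_coord[of w 0 x] that by simp
    finally have "norm (?T *v w) \<le> ?o * coord_inv_bound" using o0 by (simp add: mult_left_mono)
    then show ?thesis
      using flux_coord_le[of n x "?T *v w"] coord_bounds_ge_1
      by (meson mult_left_mono order_trans zero_le_one)
  qed
  have "2 * ?P = flux_coord n x (?T *v w1) - \<i> * flux_coord n x (?T *v w2)"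
    unfolding flux_coord_transfer c1 c2 by (simp add: algebra_simps)
  then have "cmod (2 * ?P) \<le> cmod (flux_coord n x (?T *v w1)) + cmod (flux_coord n x (?T *v w2))"
    using norm_triangle_ineq4[of "flux_coord n x (?T *v w1)" "\<i> * flux_coord n x (?T *v w2)"] by (simp add: norm_mult)
  also have "\<dots> \<le> coord_bound * (?o * coord_inv_bound) + coord_bound * (?o * coord_inv_bound)"
    by (intro add_mono b) (simp_all add: c1 c2)
  finally have "cmod ?P \<le> coord_bound * coord_inv_bound * ?o" by (simp add: norm_mult mult_ac)
  moreover have "0 \<le> coord_bound * coord_inv_bound * ?o" using coord_bounds_ge_1 o0 by simp
  ultimately show ?thesis by linarith
qed

lemma onorm_transfer_pos: "0 < onorm ((*v) (transfer_matrix a E n x))"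
proof (rule ccontr)
  assume "\<not> ?thesis"
  then have "2 * coord_bound * coord_inv_bound * onorm ((*v) (transfer_matrix a E n x)) \<le> 0"
    using coord_bounds_ge_1 by (intro mult_nonneg_nonpos) auto
  then show False using onorm_transfer_ge[of n x] orbit_product_ge_1[of n x] by linarith
qed

section \<open>From the logarithm of the norm to the Lyapunov exponent\<close>

definition log_norm :: "nat \<Rightarrow> real \<Rightarrow> real" where
  "log_norm n x = ln (onorm ((*v) (transfer_matrix a E n x)))"

text \<open>The norm and \<open>\<bar>\<alpha>\<bar>\<close> bound each other up to a factor
  independent of \<open>n\<close> and \<open>x\<close>.\<close>

lemma log_norm_close:
  "\<bar>log_norm n x - (\<Sum>j<n. log_gain j x)\<bar> \<le> ln (2 * coord_bound * coord_inv_bound)"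
proof -
  let ?c = "2 * coord_bound * coord_inv_bound" and ?P = "cmod (orbit_product n x)"
  let ?o = "onorm ((*v) (transfer_matrix a E n x))"
  have c: "0 < ?c" using coord_bounds_ge_1 by simp
  have P: "0 < ?P" using orbit_product_ge_1[of n x] by linarith
  have o: "0 < ?o" by (rule onorm_transfer_pos)
  have "ln ?o \<le> ln ?c + ln ?P"
    unfolding ln_mult_pos[OF c P, symmetric] using onorm_transfer_le[of n x] o by (rule ln_mono)
  moreover have "ln ?P \<le> ln ?c + ln ?o"
    unfolding ln_mult_pos[OF c o, symmetric] using onorm_transfer_ge[of n x] P by (rule ln_mono)
  ultimately show ?thesis
    unfolding log_norm_def ln_orbit_product[symmetric] by linarith
qed

lemma cont_a_scaled: "continuous_on S (\<lambda>x. a (c * x))"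
  by (rule continuous_on_compose2[OF a_cont]) (auto intro!: continuous_intros)

lemma cont_transfer_entry: "continuous_on S (\<lambda>x. transfer_matrix a E n x $ i $ j)"
proof (induction n arbitrary: i j)
  case (Suc n)
  have c: "continuous_on S (\<lambda>x. cocycle_step a E n x $ i $ k)" for i k
  proof -
    have nz: "a (2^n * x) \<noteq> 0" for x using a_pos[of "2^n * x"] by simp
    have "(i = 1 \<or> i = 2) \<and> (k = 1 \<or> k = 2)" using exhaust_2 by auto
    then show ?thesis
      unfolding cocycle_step_def sample_eq
      by (elim conjE disjE; simp; (intro continuous_intros cont_a_scaled ballI nz)?)
  qed
  show ?case
    unfolding transfer_matrix.simps matrix_matrix_mult_def
    by (simp add: sum_2, intro continuous_on_add continuous_on_mult c Suc)
qed (simp add: mat_def)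

lemma cont_log_norm: "continuous_on S (log_norm n)"
  unfolding log_norm_def[abs_def] using onorm_transfer_pos
  by (intro continuous_on_ln continuous_on_onorm_matrix cont_transfer_entry) (auto simp: less_imp_neq[symmetric])

lemma log_norm_periodic: "log_norm n (x + 1) = log_norm n x"
proof -
  have "sample a j (x + 1) = sample a j x" for j
    unfolding sample_eq using periodic_add_nat[of a "2^j * x" "2^j", OF a_periodic] by (simp add: algebra_simps)
  then have "cocycle_step a E j (x + 1) = cocycle_step a E j x" for j by (simp add: cocycle_step_def)
  then have "transfer_matrix a E n (x + 1) = transfer_matrix a E n x" by (induction n) auto
  then show ?thesis by (simp add: log_norm_def)
qed

text \<open>The cocycle identity and submultiplicativity give a pointwise inequality with
  \<open>log_norm n\<close> at \<open>2^k * x\<close>; invariance of the integral under doubling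
  removes the shift.\<close>

lemma mean_log_norm_subadditive:
  "integral {0..1} (log_norm (k + n)) \<le> integral {0..1} (log_norm k) + integral {0..1} (log_norm n)"
proof -
  have cs: "continuous_on {0..1} (\<lambda>x. log_norm n (2^k * x))"
    by (rule continuous_on_compose2[OF cont_log_norm[of UNIV]]) (auto intro!: continuous_intros)
  have p: "log_norm (k + n) x \<le> log_norm k x + log_norm n (2^k * x)" for x
  proof -
    have "onorm ((*v) (transfer_matrix a E (k + n) x))
       \<le> onorm ((*v) (transfer_matrix a E n (2^k * x))) * onorm ((*v) (transfer_matrix a E k x))"
    proof -
      have "(*v) (transfer_matrix a E (k + n) x) = (*v) (transfer_matrix a E n (2^k * x)) \<circ> (*v) (transfer_matrix a E k x)"
        by (rule ext) (simp add: transfer_matrix_add matrix_vector_mul_assoc)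
      then show ?thesis by (simp only:) (intro onorm_compose matrix_vector_mul_bounded_linear)
    qed
    then have "log_norm (k + n) x \<le> ln (onorm ((*v) (transfer_matrix a E n (2^k * x))) * onorm ((*v) (transfer_matrix a E k x)))"
      unfolding log_norm_def using onorm_transfer_pos by (simp add: mult_pos_pos)
    then show ?thesis unfolding log_norm_def using onorm_transfer_pos[of n "2^k * x"] onorm_transfer_pos[of k x] by (simp add: ln_mult_pos)
  qed
  have "integral {0..1} (log_norm (k + n)) \<le> integral {0..1} (\<lambda>x. log_norm k x + log_norm n (2^k * x))"
    by (intro integral_le integrable_continuous_real continuous_intros cont_log_norm cs p)
  also have "\<dots> = integral {0..1} (log_norm k) + integral {0..1} (\<lambda>x. log_norm n (2^k * x))"
    by (intro Henstock_Kurzweil_Integration.integral_add integrable_continuous_real cont_log_norm cs)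
  also have "integral {0..1} (\<lambda>x. log_norm n (2^k * x)) = integral {0..1} (log_norm n)"
    by (intro integral_doubling_invariant cont_log_norm log_norm_periodic)
  finally show ?thesis .
qed

text \<open>The additive constant of the subadditive estimate absorbs the first \<open>2 * m\<close>
  steps, the telescoping boundary terms and the coordinate change; only the error per step survives
  in the infimum.\<close>

lemma lyapunov_estimate: "\<bar>lyapunov a E - gain_rate\<bar> \<le> 520 * (R^4 * real m^2 * \<epsilon>^3)"
proof -
  have "lyapunov a E = (INF n\<in>{0<..}. (1 / real n) * integral {0..1} (log_norm n))"
    unfolding lyapunov_def log_norm_def[symmetric, abs_def] using circle_mean_eq_integral[OF cont_log_norm] by simp
  moreover have "\<bar>(INF n\<in>{0<..}. (1 / real n) * integral {0..1} (log_norm n)) - gain_rate\<bar> \<le> 520 * (R^4 * real m^2 * \<epsilon>^3)"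
  proof (rule subadditive_inf_estimate[OF mean_log_norm_subadditive])
    fix N
    have "\<bar>integral {0..1} (log_norm (2 * m + N)) - integral {0..1} (\<lambda>x. \<Sum>j<2 * m + N. log_gain j x)\<bar>
       \<le> ln (2 * coord_bound * coord_inv_bound)"
      using norm_mean_diff_le[of "log_norm (2 * m + N)" "\<lambda>x. \<Sum>j<2 * m + N. log_gain j x"] log_norm_close
      by (auto intro!: cont_log_norm continuous_intros cont_log_gain)
    then show "\<bar>integral {0..1} (log_norm (2 * m + N)) - real N * gain_rate\<bar>
       \<le> real N * (520 * (R^4 * real m^2 * \<epsilon>^3)) + (2 * real m + 3 * R^2 * \<epsilon> + ln (2 * coord_bound * coord_inv_bound))"
      using mean_total_log_gain[of N] by linarith
  qed
  ultimately show ?thesis by simp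
qed

end

section \<open>Asymptotics\<close>

text \<open>The derivative inherits the period, so being continuous it is bounded.\<close>

lemma C1_circle_lipschitz:
  assumes "C1_circle a"
  obtains K where "0 \<le> K" "\<And>x y. \<bar>a x - a y\<bar> \<le> K * \<bar>x - y\<bar>"
proof -
  from assms obtain D where per: "\<And>x. a (x + 1) = a x"
    and D: "\<And>x. (a has_vector_derivative D x) (at x)" and cD: "continuous_on UNIV D"
    unfolding C1_circle_def C1_differentiable_on_def by auto
  have d: "(a has_field_derivative D x) (at x)" for x
    using D by (simp add: has_real_derivative_iff_has_vector_derivative)
  have "D (x + 1) = D x" for x
  proof -
    have "((\<lambda>y. a (y + 1)) has_field_derivative D (x + 1)) (at x)" using d[of "x + 1"] by (simp add: DERIV_shift)
    then show ?thesis using d[of x] DERIV_unique unfolding per by blast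
  qed
  then obtain K where K: "\<And>x. \<bar>D x\<bar> \<le> K" using periodic_bounded[OF cD] by blast
  have "\<bar>a x - a y\<bar> \<le> K * \<bar>x - y\<bar>" for x y
    using field_differentiable_bound[of UNIV a D K x y] d K by simp
  moreover have "0 \<le> K" using K[of 0] by linarith
  ultimately show ?thesis using that by blast
qed

context doubling_drive
begin

text \<open>Since \<open>\<bar>\<alpha>\<^sub>n\<bar> \<ge> 1\<close>, its growth rate, whose leading term is the Green--Kubo variance, cannot be negative.\<close>

lemma green_kubo_nonneg: "0 \<le> doubling_corr r 0 + 2 * corr_sum"
proof -
  let ?V = "doubling_corr r 0 + 2 * corr_sum"
  have "((\<lambda>j. 1 / 2 ^ j * R) \<longlongrightarrow> 0) sequentially" by real_asymp
  then have "\<forall>\<^sub>F j in sequentially. 1 / 2 ^ j * R < 1/20" by (rule order_tendstoD) simp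
  then have ev: "\<forall>\<^sub>F j in sequentially. - (16640 * R^4) * (real j^2 / 2^j) \<le> ?V"
  proof eventually_elim
    case (elim j)
    \<comment> \<open>With \<open>\<epsilon> = 1 / 2^j\<close>, the memory length
      \<open>2 * j\<close> gives \<open>1 / 2^m = \<epsilon>^2\<close> exactly; after division by
      \<open>\<epsilon>^2\<close> the error is of order \<open>j^2 / 2^j\<close> and tends to
      0.\<close>
    interpret small_doubling_cocycle r R "1 / 2^j" "2 * j"
      by unfold_locales (use elim in \<open>auto simp: power_mult power_divide power2_eq_square mult_2 power_add\<close>)
    have "- (520 * (R^4 * real (2 * j)^2 * (1 / 2^j)^3)) \<le> (1 / 2^j)^2 * (?V / 8)"
      using gain_rate_lower unfolding gain_rate_def .
    moreover have "520 * (R^4 * real (2 * j)^2 * (1 / 2^j)^3) = (1 / 2^j)^2 * (2080 * R^4 * (real j^2 / 2^j))"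
      by (simp add: power2_eq_square power3_eq_cube)
    ultimately have "(1 / 2^j)^2 * (- (2080 * R^4 * (real j^2 / 2^j))) \<le> (1 / 2^j)^2 * (?V / 8)" by simp
    then have "- (2080 * R^4 * (real j^2 / 2^j)) \<le> ?V / 8" by (rule mult_left_le_imp_le) simp
    then show ?case by simp
  qed
  have "(\<lambda>j. - (16640 * R^4) * (real j^2 / 2^j)) \<longlonglongrightarrow> - (16640 * R^4) * 0"
    by (intro tendsto_mult tendsto_const) real_asymp
  then show ?thesis using tendsto_upperbound[OF _ ev] by simp
qed

end

text \<open>This ceiling is the memory length chosen for the final asymptotics.\<close>

lemma power_of_two_large:
  assumes "0 < \<epsilon>"
  shows "1 / 2 ^ nat \<lceil>2 * log 2 (1 / \<epsilon>)\<rceil> \<le> \<epsilon>^2"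
proof -
  have "(1 / \<epsilon>)^2 = 2 powr (2 * log 2 (1 / \<epsilon>))"
    using assms by (simp add: powr_mult_base powr_powr[symmetric] mult.commute[of 2] powr_numeral)
  also have "\<dots> \<le> 2 powr real (nat \<lceil>2 * log 2 (1 / \<epsilon>)\<rceil>)" by (intro powr_mono) (auto simp: real_nat_ceiling_ge)
  finally have "(1 / \<epsilon>)^2 \<le> 2 ^ nat \<lceil>2 * log 2 (1 / \<epsilon>)\<rceil>" by (simp add: powr_realpow)
  then show ?thesis using assms by (simp add: power_divide field_simps)
qed

text \<open>The logarithm equals \<open>(ln \<kappa> - ln E) / ln 2\<close>, and \<open>ln 2\<close>
  is at least 2/3. As \<open>E \<le> exp (- 1)\<close> forces
  \<open>\<bar>ln E\<bar> \<ge> 1\<close>, additive constants can be absorbed into multiples of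
  it.\<close>

lemma memory_length_bound:
  assumes "0 < E" "E \<le> exp (- 1)" "E < \<kappa>"
  shows "real (nat \<lceil>2 * log 2 (1 / sqrt (E / \<kappa>))\<rceil>) \<le> (3/2 * \<bar>ln \<kappa>\<bar> + 5/2) * \<bar>ln E\<bar>"
proof -
  have k: "0 < \<kappa>" using assms by linarith
  have "ln E \<le> -1" using assms by (metis ln_exp ln_mono)
  then have lE: "1 \<le> \<bar>ln E\<bar>" "ln E = - \<bar>ln E\<bar>" by auto
  have "2 * log 2 (1 / sqrt (E / \<kappa>)) = (ln \<kappa> - ln E) / ln 2"
    using assms k by (simp add: log_def ln_div ln_sqrt field_simps)
  moreover have "\<dots> \<le> (\<bar>ln \<kappa>\<bar> + \<bar>ln E\<bar>) / (2/3)"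
    using lE ln2_ge_two_thirds by (intro frac_le) auto
  moreover have "0 \<le> (ln \<kappa> - ln E) / ln 2" using assms k by simp
  moreover have "real (nat \<lceil>y\<rceil>) \<le> y + 1" if "0 \<le> y" for y :: real
    using that of_int_ceiling_le_add_one[of y] by simp
  moreover have "(\<bar>ln \<kappa>\<bar> + \<bar>ln E\<bar>) / (2/3) = 3/2 * (\<bar>ln \<kappa>\<bar> + \<bar>ln E\<bar>)" by simp
  ultimately have "real (nat \<lceil>2 * log 2 (1 / sqrt (E / \<kappa>))\<rceil>) \<le> 3/2 * (\<bar>ln \<kappa>\<bar> + \<bar>ln E\<bar>) + 1"
    by (metis add_right_mono order_trans)
  also have "\<dots> \<le> 3/2 * (\<bar>ln \<kappa>\<bar> * \<bar>ln E\<bar> + \<bar>ln E\<bar>) + \<bar>ln E\<bar>"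
  proof -
    have "3/2 * (A + B) + 1 \<le> 3/2 * (P + B) + B" if "1 \<le> B" "A \<le> P" for A B P :: real
      using that by argo
    then show ?thesis using lE(1) mult_left_mono[OF lE(1) abs_ge_zero[of "ln \<kappa>"]] by simp
  qed
  finally show ?thesis by (simp add: algebra_simps)
qed

theorem theorem1p3:
  fixes a :: "real \<Rightarrow> real"
  assumes "C1_circle a"
    and "0 < (INF x. ereal (a x))"
    and "(INF x. ereal (a x)) < (SUP x. ereal (a x))"
    and "(SUP x. ereal (a x)) < \<infinity>"
  shows "summable (\<lambda>s. q_corr a (Suc s)) \<and>
         c_coeff a \<ge> 0 \<and>
         (\<lambda>E. lyapunov a E - c_coeff a * E) \<in> O[at_right 0](\<lambda>E. \<bar>ln E\<bar>\<^sup>2 * E powr (3/2))"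
proof -
  obtain K where K: "0 \<le> K" "\<And>x y. \<bar>a x - a y\<bar> \<le> K * \<bar>x - y\<bar>" using C1_circle_lipschitz[OF assms(1)] by blast
  have per: "a (x + 1) = a x" for x using assms(1) by (simp add: C1_circle_def)
  have ca: "continuous_on S a" for S
    using assms(1) C1_differentiable_imp_continuous_on continuous_on_subset unfolding C1_circle_def by blast
  obtain lo where lo: "0 < lo" "\<And>x. lo \<le> a x"
  proof -
    obtain lo where "0 < ereal lo" "ereal lo < (INF x. ereal (a x))" using ereal_dense2[OF assms(2)] by blast
    then show ?thesis using that[of lo] by (metis INF_lower UNIV_I ereal_less(2) ereal_less_eq(3) less_imp_le order_trans)
  qed
  obtain hi where hi: "\<And>x. a x \<le> hi"
  proof -
    obtain hi where "(SUP x. ereal (a x)) < ereal hi" using ereal_dense2[OF assms(4)] by blast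
    then show ?thesis using that[of hi] by (metis SUP_upper UNIV_I ereal_less_eq(3) less_imp_le order_trans)
  qed
  have apos: "0 < a x" for x using lo by (meson less_le_trans)
  define k where "k = kappa a"
  have cinv: "continuous_on S (\<lambda>x. inverse (a x))" for S
    by (intro continuous_intros ca) (use apos in \<open>auto simp: less_imp_neq[symmetric]\<close>)
  have kI: "k = inverse (integral {0..1} (\<lambda>x. inverse (a x)))"
    unfolding k_def kappa_def circle_mean_eq_integral[OF cinv] ..
  have "inverse hi \<le> integral {0..1} (\<lambda>x. inverse (a x))"
  proof -
    have "integral {0..1} (\<lambda>x::real. inverse hi) \<le> integral {0..1} (\<lambda>x. inverse (a x))"
      by (intro integral_le integrable_continuous_real cinv continuous_intros le_imp_inverse_le hi apos)
    then show ?thesis by simp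
  qed
  moreover have "0 < hi" using apos[of 0] hi[of 0] by linarith
  ultimately have kpos: "0 < k" unfolding kI by (simp add: less_le_trans[OF positive_imp_inverse_positive])
  \<comment> \<open>This is \<open>\<kappa> q\<close>; its mean is 0 because \<open>k\<close> is the
    harmonic mean of \<open>a\<close>.\<close>
  define r where "r = (\<lambda>x. 1 - k / a x)"
  \<comment> \<open>\<open>1 + k / lo\<close> bounds the size of \<open>r\<close>, and
    \<open>k * K / lo^2\<close> is a Lipschitz constant for \<open>k / a\<close>.\<close>
  define R where "R = 1 + k / lo + k * K / lo^2"
  have kdiv: "0 \<le> k / lo" "0 \<le> k * K / lo^2" using kpos lo(1) K(1) by auto
  interpret doubling_drive r R
  proof
    show "r (x + 1) = r x" for x by (simp add: r_def per)
    show "1 \<le> R" using kdiv by (simp add: R_def)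
    show "\<bar>r x\<bar> \<le> R" for x
    proof -
      have "k / a x \<le> k / lo" using kpos lo(1) lo(2)[of x] apos[of x] by (intro divide_left_mono) auto
      moreover have "0 < k / a x" using kpos apos by simp
      ultimately show ?thesis unfolding r_def R_def using kdiv by (simp add: abs_le_iff)
    qed
    show "\<bar>r x - r y\<bar> \<le> R * \<bar>x - y\<bar>" for x y
    proof -
      have "r x - r y = k * (a x - a y) / (a x * a y)"
        using apos[of x] apos[of y] by (simp add: r_def field_simps)
      then have "\<bar>r x - r y\<bar> = k * \<bar>a x - a y\<bar> / (a x * a y)"
        using apos[of x] apos[of y] kpos by (simp add: abs_mult)
      also have "\<dots> \<le> k * (K * \<bar>x - y\<bar>) / lo^2"
        unfolding power2_eq_square using kpos K lo apos by (intro frac_le mult_left_mono mult_mono) (auto simp: less_imp_le)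
      also have "\<dots> = k * K / lo^2 * \<bar>x - y\<bar>" by simp
      also have "\<dots> \<le> R * \<bar>x - y\<bar>" unfolding R_def using kdiv by (intro mult_right_mono) auto
      finally show ?thesis .
    qed
    have "((\<lambda>x. 1 - k * inverse (a x)) has_integral (integral {0..1} (\<lambda>x::real. 1) - k * integral {0..1} (\<lambda>x. inverse (a x)))) {0..1}"
      by (intro has_integral_diff has_integral_mult_right mean_has_integral cinv continuous_intros)
    moreover have "k * integral {0..1} (\<lambda>x. inverse (a x)) = 1" using kpos unfolding kI by simp
    ultimately show "integral {0..1} r = 0" unfolding r_def by (intro integral_unique) (simp add: divide_inverse)
  qed
  have q: "q_fun a x = r x / k" for x
    using kpos apos[of x] by (simp add: q_fun_def k_def[symmetric] r_def field_simps)
  have qc: "q_corr a s = doubling_corr r s / k^2" for s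
  proof -
    have "q_corr a s = integral {0..1} (\<lambda>x. q_fun a x * q_fun a (2^s * x))"
      unfolding q_corr_def q
      by (intro circle_mean_eq_integral continuous_intros cont_r cont_r_scaled) (use kpos in auto)
    also have "\<dots> = integral {0..1} (\<lambda>x. inverse (k^2) * (r x * r (2^s * x)))"
      unfolding q by (simp add: divide_inverse power2_eq_square mult_ac)
    finally show ?thesis unfolding doubling_corr_def by (simp add: divide_inverse mult.commute)
  qed
  let ?V = "doubling_corr r 0 + 2 * corr_sum"
  \<comment> \<open>Passing from \<open>q\<close> to \<open>r\<close> divides correlations by
    \<open>k^2\<close> and turns the prefactor \<open>k / 8\<close> into
    \<open>1 / (8 * k)\<close>.\<close>
  have c: "c_coeff a = ?V / (8 * k)"
  proof -
    have "circle_mean (\<lambda>x. (q_fun a x)\<^sup>2) = doubling_corr r 0 / k^2"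
      using qc[of 0] unfolding q_corr_def by (simp add: power2_eq_square)
    moreover have "(\<Sum>s. q_corr a (Suc s)) = corr_sum / k^2"
      unfolding qc corr_sum_def by (rule suminf_divide[OF corr_summable])
    ultimately show ?thesis
      unfolding c_coeff_def k_def[symmetric] using kpos by (simp add: field_simps power2_eq_square)
  qed
  \<comment> \<open>The error \<open>520 * R^4 * m^2 * \<epsilon>^3\<close> with the memory bound
    for \<open>m\<close> and \<open>\<epsilon>^3 = (E / k) powr (3/2)\<close>.\<close>
  define C where "C = 520 * R^4 * (3/2 * \<bar>ln k\<bar> + 5/2)^2 / k powr (3/2)"
  \<comment> \<open>The first bound gives \<open>\<bar>ln E\<bar> \<ge> 1\<close>, the second
    \<open>\<epsilon> * R \<le> 1/20\<close>.\<close>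
  define E0 where "E0 = min (exp (- 1)) (k / (20 * R)^2)"
  have E0: "0 < E0" unfolding E0_def using kpos R_ge_1 by simp
  have bound: "\<bar>lyapunov a E - c_coeff a * E\<bar> \<le> C * (\<bar>ln E\<bar>\<^sup>2 * E powr (3/2))" if E: "0 < E" "E < E0" for E
  proof -
    define \<epsilon> where "\<epsilon> = sqrt (E / k)"
    define m where "m = nat \<lceil>2 * log 2 (1 / \<epsilon>)\<rceil>"
    have eps: "0 < \<epsilon>" unfolding \<epsilon>_def using E kpos by simp
    have Ek: "E / k \<le> (1 / (20 * R))^2"
      using E kpos R_ge_1 by (simp add: E0_def power_divide field_simps)
    then have "\<epsilon> \<le> 1 / (20 * R)" unfolding \<epsilon>_def using R_ge_1 by (intro real_le_lsqrt) auto
    then have epsR: "\<epsilon> * R \<le> 1/20" using R_ge_1 by (simp add: field_simps)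
    have "(1 / (20 * R))^2 < 1" using R_ge_1 by (simp add: power_less_one_iff abs_square_less_1)
    then have "E / k < 1" using Ek by linarith
    then have "E < k" using kpos by simp
    interpret div_grad_cocycle r R \<epsilon> m a E "\<epsilon> * k" hi
    proof unfold_locales
      show "1 / 2 ^ m \<le> \<epsilon>\<^sup>2" unfolding m_def by (rule power_of_two_large[OF eps])
      have "\<epsilon> * \<epsilon> = E / k" unfolding \<epsilon>_def using E kpos by simp
      then show "E = \<epsilon> * (\<epsilon> * k)" using kpos by (simp add: field_simps)
    qed (use eps epsR per ca apos hi kpos in \<open>auto simp: r_def\<close>)
    have m_bound: "real m \<le> (3/2 * \<bar>ln k\<bar> + 5/2) * \<bar>ln E\<bar>"
      unfolding m_def \<epsilon>_def by (rule memory_length_bound) (use E \<open>E < k\<close> in \<open>auto simp: E0_def\<close>)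
    have "\<epsilon>^2 = E / k" unfolding \<epsilon>_def using E kpos by simp
    then have "gain_rate = c_coeff a * E" unfolding gain_rate_def c by (simp add: mult.commute)
    then have "\<bar>lyapunov a E - c_coeff a * E\<bar> \<le> 520 * (R^4 * real m^2 * \<epsilon>^3)" using lyapunov_estimate by simp
    also have "\<epsilon>^3 = E powr (3/2) / k powr (3/2)"
    proof -
      have "\<epsilon>^3 = (E / k) powr (3/2)"
        unfolding \<epsilon>_def using E kpos by (simp add: powr_half_sqrt[symmetric] powr_power)
      then show ?thesis using E kpos by (simp add: powr_divide)
    qed
    also have "520 * (R^4 * real m^2 * (E powr (3/2) / k powr (3/2)))
       \<le> 520 * (R^4 * ((3/2 * \<bar>ln k\<bar> + 5/2) * \<bar>ln E\<bar>)^2 * (E powr (3/2) / k powr (3/2)))"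
      by (intro mult_left_mono mult_right_mono power_mono m_bound) (use R_ge_1 in auto)
    also have "\<dots> = C * (\<bar>ln E\<bar>\<^sup>2 * E powr (3/2))" unfolding C_def by (simp add: power_mult_distrib)
    finally show ?thesis .
  qed
  have "(\<lambda>E. lyapunov a E - c_coeff a * E) \<in> O[at_right 0](\<lambda>E. \<bar>ln E\<bar>\<^sup>2 * E powr (3/2))"
  proof (rule bigoI)
    show "\<forall>\<^sub>F E in at_right 0. norm (lyapunov a E - c_coeff a * E) \<le> C * norm (\<bar>ln E\<bar>\<^sup>2 * E powr (3/2))"
      using bound E0 unfolding eventually_at_right_field by (auto simp: abs_mult intro!: exI[of _ E0])
  qed
  moreover have "0 \<le> c_coeff a" unfolding c using green_kubo_nonneg kpos by simp
  moreover have "summable (\<lambda>s. q_corr a (Suc s))" unfolding qc by (rule summable_divide[OF corr_summable])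
  ultimately show ?thesis by blast
qed

end
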